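(* Let $1\le n\le N$ be integers, $\alpha,\beta>-1$ real, $\delta>0$, and $\nu\in\mathbb{C}$ with $\operatorname{Re}\nu<n$. Let $f:\mathbb{R}\to\mathbb{C}$ be continuous and absolutely integrable with $f(x)=O(x^{\operatorname{Re}\nu-n-\varepsilon})$ as $x\to\infty$ for some $\varepsilon>0$, and suppose that the approximate fractional orthogonal derivative $g:=W_\delta^{\nu,n}[f]$ associated with the Hahn polynomials is absolutely integrable. Let $F$ and $G$ be the Fourier transforms of $f$ and $g$. Then for every real $\omega\ne0$ one has $G(\omega)=H_\delta^\nu(\omega)F(\omega)$ with transfer function $$H_\delta^\nu(\omega)=(i\omega)^{\nu-n}\,\frac{(1-e^{-i\delta\omega})^n}{\delta^n}\,\frac{\Gamma(N+\beta+1)\,\Gamma(2n+\alpha+\beta+2)}{\Gamma(n+\beta+1)\,\Gamma(N+n+\alpha+\beta+2)}\,F\!\left(-N+n,\,\alpha+n+1;\,-\beta-N;\,e^{-i\delta\omega}\right).$$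
   Context: In the last factor, $F(-N+n,\alpha+n+1;-\beta-N;z)=\sum_{k=0}^{N-n}\frac{(-N+n)_k(\alpha+n+1)_k}{(-\beta-N)_k}\frac{z^k}{k!}$ is the terminating Gauss hypergeometric series (not to be confused with the Fourier transform $F(\omega)$), and $(a)_k=a(a+1)\cdots(a+k-1)$. Fourier transform: $F(\omega)=\frac{1}{\sqrt{2\pi}}\int_{-\infty}^\infty e^{i\omega x}f(x)\,dx$, and likewise for $G$. Powers: $z^\nu=e^{\nu\ln z}$ with $-\pi<\arg z<\pi$; in particular $(i\omega)^\nu=e^{\nu(\ln|\omega|+i\pi\,\mathrm{sgn}(\omega)/2)}$ for real $\omega\ne0$. Weyl fractional integral ($\operatorname{Re}\lambda>0$): $W^{-\lambda}[f](x)=\frac{1}{\Gamma(\lambda)}\int_x^\infty f(y)(y-x)^{\lambda-1}dy$. Hahn polynomials: $Q_n(j;\alpha,\beta,N)=\sum_{k=0}^{n}\frac{(-n)_k(n+\alpha+\beta+1)_k(-j)_k}{(\alpha+1)_k(-N)_k\,k!}$, orthogonal on $\{0,1,\ldots,N\}$ with respect to the weights $w(j)=\frac{(\alpha+1)_j(\beta+1)_{N-j}}{j!\,(N-j)!}$. Let $k_n$ be the leading coefficient of $Q_n(\cdot;\alpha,\beta,N)$ and $h_n=\sum_{j=0}^NQ_n(j;\alpha,\beta,N)^2w(j)$. Put $$D_\delta^n[f](x)=\frac{k_n\,n!}{h_n}\frac{1}{\delta^n}\sum_{j=0}^Nf(x+j\delta)\,w(j)\,Q_n(j;\alpha,\beta,N),$$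 and $W_\delta^{\nu,n}[f](x)=(-1)^nD_\delta^n\big[W^{\nu-n}[f]\big](x)$ for $\operatorname{Re}\nu<n$. *)

theory Defs
  imports
    "HOL-Analysis.Analysis"
    "HOL-Computational_Algebra.Polynomial"
    "HOL-Library.Landau_Symbols"
begin

definition fourier :: "(real \<Rightarrow> complex) \<Rightarrow> real \<Rightarrow> complex" where
  "fourier f \<omega> =
     complex_of_real (1 / sqrt (2 * pi)) * (LINT x|lborel. exp (\<i> * of_real (\<omega> * x)) * f x)"

text \<open>
  \<open>weyl_integral \<mu> f\<close> is the Weyl fractional integral $W^{-\mu}[f]$, meant for
  $\mathrm{Re}\,\mu > 0$.
\<close>
definition weyl_integral :: "complex \<Rightarrow> (real \<Rightarrow> complex) \<Rightarrow> real \<Rightarrow> complex" where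
  "weyl_integral \<mu> f x =
     1 / Gamma \<mu> * (LINT y:{x..}|lborel. f y * complex_of_real (y - x) powr (\<mu> - 1))"

text \<open>
  The Hahn polynomial $Q_n(\cdot;\alpha,\beta,N)$ as a formal polynomial, so that its leading
  coefficient is available; \<open>[:0, -1:]\<close> is the polynomial $-j$ in the variable $j$.
\<close>
definition hahn_poly :: "nat \<Rightarrow> real \<Rightarrow> real \<Rightarrow> nat \<Rightarrow> real poly" where
  "hahn_poly n \<alpha> \<beta> N =
     (\<Sum>k=0..n. smult (pochhammer (- real n) k * pochhammer (real n + \<alpha> + \<beta> + 1) k /
                        (pochhammer (\<alpha> + 1) k * pochhammer (- real N) k * fact k))
                      (pochhammer [:0, -1:] k))"

lemma poly_hahn_poly:
  "poly (hahn_poly n \<alpha> \<beta> N) j =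
     (\<Sum>k=0..n. pochhammer (- real n) k * pochhammer (real n + \<alpha> + \<beta> + 1) k * pochhammer (- j) k /
                  (pochhammer (\<alpha> + 1) k * pochhammer (- real N) k * fact k))"
proof -
  have "poly (pochhammer [:0, -1:] k) j = pochhammer (- j) k" for k
    by (simp add: pochhammer_prod poly_prod poly_of_nat algebra_simps)
  then show ?thesis
    by (simp add: hahn_poly_def poly_sum)
qed

definition hahn_weight :: "real \<Rightarrow> real \<Rightarrow> nat \<Rightarrow> nat \<Rightarrow> real" where
  "hahn_weight \<alpha> \<beta> N j =
     pochhammer (\<alpha> + 1) j * pochhammer (\<beta> + 1) (N - j) / (fact j * fact (N - j))"

definition hahn_norm :: "nat \<Rightarrow> real \<Rightarrow> real \<Rightarrow> nat \<Rightarrow> real" where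
  "hahn_norm n \<alpha> \<beta> N =
     (\<Sum>j=0..N. (poly (hahn_poly n \<alpha> \<beta> N) (real j))\<^sup>2 * hahn_weight \<alpha> \<beta> N j)"

definition hahn_derivative ::
    "nat \<Rightarrow> real \<Rightarrow> real \<Rightarrow> nat \<Rightarrow> real \<Rightarrow> (real \<Rightarrow> complex) \<Rightarrow> real \<Rightarrow> complex" where
  "hahn_derivative n \<alpha> \<beta> N \<delta> f x =
     complex_of_real (lead_coeff (hahn_poly n \<alpha> \<beta> N) * fact n / hahn_norm n \<alpha> \<beta> N * (1 / \<delta> ^ n)) *
     (\<Sum>j=0..N. f (x + real j * \<delta>) *
        complex_of_real (hahn_weight \<alpha> \<beta> N j * poly (hahn_poly n \<alpha> \<beta> N) (real j)))"

text \<open>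
  $W_\delta^{\nu,n}[f] = (-1)^n D_\delta^n[W^{\nu-n}[f]]$, meant for $\mathrm{Re}\,\nu < n$.
\<close>
definition hahn_fractional_derivative ::
    "complex \<Rightarrow> nat \<Rightarrow> real \<Rightarrow> real \<Rightarrow> nat \<Rightarrow> real \<Rightarrow> (real \<Rightarrow> complex) \<Rightarrow> real \<Rightarrow> complex" where
  "hahn_fractional_derivative \<nu> n \<alpha> \<beta> N \<delta> f x =
     (- 1) ^ n * hahn_derivative n \<alpha> \<beta> N \<delta> (weyl_integral (of_nat n - \<nu>) f) x"

text \<open>
  The terminating Gauss series $F(-m, b; c; z)$. The sum is cut off at \<open>m\<close> because
  \<open>c\<close> may be a negative integer below \<open>-m\<close>.
\<close>
definition hypergeom_terminating :: "nat \<Rightarrow> complex \<Rightarrow> complex \<Rightarrow> complex \<Rightarrow> complex" where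
  "hypergeom_terminating m b c z =
     (\<Sum>k=0..m. pochhammer (- of_nat m) k * pochhammer b k / pochhammer c k * (z ^ k / fact k))"

definition hahn_transfer ::
    "complex \<Rightarrow> nat \<Rightarrow> real \<Rightarrow> real \<Rightarrow> nat \<Rightarrow> real \<Rightarrow> real \<Rightarrow> complex" where
  "hahn_transfer \<nu> n \<alpha> \<beta> N \<delta> \<omega> =
     (\<i> * of_real \<omega>) powr (\<nu> - of_nat n) *
     ((1 - exp (- \<i> * of_real (\<delta> * \<omega>))) ^ n / of_real (\<delta> ^ n)) *
     complex_of_real
       (Gamma (real N + \<beta> + 1) * Gamma (2 * real n + \<alpha> + \<beta> + 2) /
        (Gamma (real n + \<beta> + 1) * Gamma (real N + real n + \<alpha> + \<beta> + 2))) *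
     hypergeom_terminating (N - n) (of_real (\<alpha> + real n + 1)) (of_real (- \<beta> - real N))
       (exp (- \<i> * of_real (\<delta> * \<omega>)))"

end

(*
  Write mu = n - nu, so that Re mu > 0, and K(t) = t^(mu-1) / Gamma(mu) for t > 0.

  The transform of g is, formally, that of W^(-mu)[f], which is (i omega)^(-mu) F(omega), times the
  generating function of w(j) Q_n(j) at z = e^(-i delta omega). The backward shift relation writes
  w(j) Q_n(j) as an n-fold difference of the weight with parameters (alpha+n, beta+n, N-n); summation
  by parts then produces the factor (1-z)^n and a 2F1, and also gives h_n.

  W^(-mu)[f] need not be integrable, so the Fourier transform cannot be taken termwise. Instead one
  applies an M-fold difference with step h and M > Re mu: the difference moves to the kernel, where
  it produces an integrable function whose transform is (1 - e^(-i h omega))^M (i omega)^(-mu) (an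
  Abel limit of Laplace transforms). Fubini then applies, and the extra factor cancels because the
  step h = pi / |omega| makes it nonzero.
*)
theory Submission
  imports Defs
begin

section \<open>Rodrigues formula for Hahn polynomials\<close>

text \<open>The Rodrigues formula is stated only in weak form, as a sum against an arbitrary
  sequence \<open>y\<close>, so that one identity serves twice: \<open>y j = z ^ j\<close> gives the
  generating function, and \<open>y j = pochhammer (- j) k\<close> gives orthogonality to lower
  degrees and hence the norm. Its source, the backward shift, is checked in the Pochhammer basis,
  where the shift operator produces only two terms. Before any Abel limit, the Laplace transform of
  the kernel is needed at complex points of the right half-plane. It comes without contour rotation
  from the real Gamma integral, by a binomial series around a suitable real point. On the Fourier
  side the assumed integrability of g is decisive: the difference of g has a transform that is a
  known multiple of that of g, and the same difference is a finite sum of translates of the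
  differenced Weyl integral.\<close>

definition hahn_coeff :: "nat \<Rightarrow> real \<Rightarrow> real \<Rightarrow> nat \<Rightarrow> nat \<Rightarrow> real" where
  "hahn_coeff n \<alpha> \<beta> N k =
     pochhammer (- real n) k * pochhammer (real n + \<alpha> + \<beta> + 1) k /
       (pochhammer (\<alpha> + 1) k * pochhammer (- real N) k * fact k)"

lemma hahn_poly_eq_sum_coeff:
  "hahn_poly n \<alpha> \<beta> N = (\<Sum>k\<le>n. smult (hahn_coeff n \<alpha> \<beta> N k) (pochhammer [:0, -1:] k))"
  by (simp add: hahn_poly_def hahn_coeff_def atLeast0AtMost)

lemma poly_hahn_poly_eq_sum_coeff:
  "poly (hahn_poly n \<alpha> \<beta> N) x = (\<Sum>k\<le>n. hahn_coeff n \<alpha> \<beta> N k * pochhammer (- x) k)"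
  by (simp add: poly_hahn_poly hahn_coeff_def atLeast0AtMost field_simps)

lemma hahn_coeff_Suc_Suc:
  assumes "\<alpha> > -1"
  shows "(\<alpha> + 1) * (real N + 1) * hahn_coeff (Suc n) \<alpha> \<beta> (Suc N) (Suc i) =
           (real n + 1) * (real n + \<alpha> + \<beta> + 2) / (real i + 1) * hahn_coeff n (\<alpha> + 1) (\<beta> + 1) N i"
proof -
  have e: "- real (Suc n) + 1 = - real n" "- real (Suc N) + 1 = - real N"
     "real (Suc n) + \<alpha> + \<beta> + 1 + 1 = real n + (\<alpha> + 1) + (\<beta> + 1) + 1"
     "real (Suc n) + \<alpha> + \<beta> + 1 = real n + \<alpha> + \<beta> + 2"
    by auto
  \<comment> \<open>A denominator such as (-N)_i may vanish; both sides are then 0, since x / 0 =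
    0.\<close>
  have *: "(a * N1) * ((- n1 * P1) * (s * P2) / ((a * Q1) * (- N1 * Q2) * (i1 * F)))
      = n1 * s / i1 * (P1 * P2 / (Q1 * Q2 * F))"
    if "a \<noteq> 0" "N1 \<noteq> 0" "i1 \<noteq> 0" for a N1 n1 P1 s P2 Q1 Q2 i1 F :: real
    using that by (cases "Q1 = 0 \<or> Q2 = 0 \<or> F = 0") (auto simp: divide_simps)
  have f: "fact (Suc i) = (real i + 1) * fact i"
    by simp
  show ?thesis
    unfolding hahn_coeff_def pochhammer_rec e f
    using *[of "\<alpha> + 1" "real N + 1" "real i + 1" "real n + 1"] assms
    by (simp only: of_nat_Suc) (simp add: add_ac)
qed

lemma hahn_coeff_step:
  assumes "\<alpha> > -1" "i \<le> n" "n \<le> N"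
  shows "(real N - real i) * (real i + \<alpha> + 2) * hahn_coeff n (\<alpha> + 1) \<beta>' N (Suc i) =
           (real n - real i) * (real n + \<alpha> + \<beta>' + 2 + real i) / (real i + 1) * hahn_coeff n (\<alpha> + 1) \<beta>' N i"
proof (cases "i = n")
  \<comment> \<open>If also n = N, the factor N - i is 0 and cannot be cancelled. For i = n the left
    side vanishes through (-n)_(n+1) = 0, the right side through n - i = 0.\<close>
  case True
  then have "pochhammer (- real n) (Suc i) = 0"
    by (simp add: pochhammer_eq_0_iff)
  then show ?thesis using True by (simp add: hahn_coeff_def)
next
  case False
  then have lt: "real i < real N" using assms by auto
  have *: "NI * s * ((P1 * (-ni)) * (P2 * t) / ((Q1 * s) * (Q2 * (- NI)) * (i1 * F)))
      = ni * t / i1 * (P1 * P2 / (Q1 * Q2 * F))"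
    if "NI \<noteq> 0" "i1 \<noteq> 0" "s \<noteq> 0" for NI i1 P1 ni P2 t Q1 s Q2 F :: real
    using that by (cases "Q1 = 0 \<or> Q2 = 0 \<or> F = 0") (auto simp: divide_simps)
  have f: "fact (Suc i) = (real i + 1) * fact i"
    by simp
  have e: "- real n + real i = - (real n - real i)" "- real N + real i = - (real N - real i)"
     "\<alpha> + 1 + 1 + real i = real i + \<alpha> + 2"
     "real n + (\<alpha> + 1) + \<beta>' + 1 + real i = real n + \<alpha> + \<beta>' + 2 + real i"
    by auto
  show ?thesis
    unfolding hahn_coeff_def pochhammer_Suc e f
    by (rule *) (use lt assms in auto)
qed

text \<open>This is the backward shift read off at the basis element
  \<open>pochhammer (- x) (Suc i)\<close>. All terms are multiples of the i-th coefficient of the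
  shifted polynomial, so only the polynomial identity \<open>*\<close> remains.\<close>

lemma hahn_coeff_backward_shift:
  assumes "\<alpha> > -1" "i \<le> n" "n \<le> N"
  shows "(\<alpha> + 1) * (real N + 1) * hahn_coeff (Suc n) \<alpha> \<beta> (Suc N) (Suc i) =
           (real N - real i) * (real i + \<alpha> + 2) * hahn_coeff n (\<alpha> + 1) (\<beta> + 1) N (Suc i) +
           (real i + \<alpha> + \<beta> + 2) * hahn_coeff n (\<alpha> + 1) (\<beta> + 1) N i"
proof -
  have *: "(real n + 1) * (real n + \<alpha> + \<beta> + 2) =
    (real n - real i) * (real n + \<alpha> + (\<beta> + 1) + 2 + real i) + (real i + 1) * (real i + \<alpha> + \<beta> + 2)"
    by algebra
  show ?thesis
    unfolding hahn_coeff_Suc_Suc[OF assms(1)] hahn_coeff_step[OF assms] *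
    by (simp add: field_simps)
qed

text \<open>Since x (1-x)_k = -(-x)_(k+1), the operator of the backward shift maps a basis element
  to a combination of itself and the next one.\<close>

lemma pochhammer_backward_shift:
  fixes x :: real
  shows "(x + \<alpha> + 1) * (N + 1 - x) * pochhammer (- x) k - x * (\<beta> + N + 2 - x) * pochhammer (1 - x) k
    = (N + 1 - real k) * (real k + \<alpha> + 1) * pochhammer (- x) k
      + (real k + \<alpha> + \<beta> + 2) * pochhammer (- x) (Suc k)"
proof -
  have "x * pochhammer (1 - x) k = - pochhammer (- x) (Suc k)"
    by (simp add: pochhammer_rec)
  also have "\<dots> = - (pochhammer (- x) k * (real k - x))"
    by (simp add: pochhammer_Suc)
  finally have *: "x * pochhammer (1 - x) k = - (pochhammer (- x) k * (real k - x))" .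
  have "(x + \<alpha> + 1) * (N + 1 - x) * pochhammer (- x) k - x * (\<beta> + N + 2 - x) * pochhammer (1 - x) k
     = (x + \<alpha> + 1) * (N + 1 - x) * pochhammer (- x) k - (\<beta> + N + 2 - x) * (x * pochhammer (1 - x) k)"
    by simp
  also have "\<dots> = (N + 1 - real k) * (real k + \<alpha> + 1) * pochhammer (- x) k
      + (real k + \<alpha> + \<beta> + 2) * pochhammer (- x) (Suc k)"
    unfolding * pochhammer_Suc by (simp add: algebra_simps)
  finally show ?thesis .
qed

lemma hahn_poly_backward_shift:
  assumes "\<alpha> > -1" "n \<le> N"
  shows "(\<alpha> + 1) * (real N + 1) * poly (hahn_poly (Suc n) \<alpha> \<beta> (Suc N)) x =
     (x + \<alpha> + 1) * (real N + 1 - x) * poly (hahn_poly n (\<alpha> + 1) (\<beta> + 1) N) x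
     - x * (\<beta> + real N + 2 - x) * poly (hahn_poly n (\<alpha> + 1) (\<beta> + 1) N) (x - 1)"
proof -
  let ?a = "hahn_coeff n (\<alpha> + 1) (\<beta> + 1) N" and ?b = "hahn_coeff (Suc n) \<alpha> \<beta> (Suc N)"
  let ?\<phi> = "\<lambda>k. pochhammer (- x) k"
  define u where "u k = (real N + 1 - real k) * (real k + \<alpha> + 1) * ?a k * ?\<phi> k" for k
  define v where "v k = (real k + \<alpha> + \<beta> + 2) * ?a k * ?\<phi> (Suc k)" for k
  \<comment> \<open>(-n)_(n+1) = 0, so \<open>u (Suc n)\<close> vanishes and the two sums run over
    the same range.\<close>
  have aSuc: "?a (Suc n) = 0"
    by (simp add: hahn_coeff_def pochhammer_eq_0_iff)
  have b: "(\<alpha> + 1) * (real N + 1) * ?b (Suc i) * ?\<phi> (Suc i) = u (Suc i) + v i" if "i \<le> n" for i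
    unfolding hahn_coeff_backward_shift[OF assms(1) that assms(2)] u_def v_def
    by (simp add: algebra_simps)
  have "(\<alpha> + 1) * (real N + 1) * poly (hahn_poly (Suc n) \<alpha> \<beta> (Suc N)) x
      = (\<Sum>k\<le>Suc n. (\<alpha> + 1) * (real N + 1) * ?b k * ?\<phi> k)"
    unfolding poly_hahn_poly_eq_sum_coeff sum_distrib_left by (simp only: mult.assoc)
  also have "\<dots> = u 0 + (\<Sum>i\<le>n. u (Suc i) + v i)"
    unfolding sum.atMost_Suc_shift
    by (intro arg_cong2[where f="(+)"] sum.cong refl b) (simp_all add: u_def hahn_coeff_def)
  also have "\<dots> = (\<Sum>i\<le>Suc n. u i) + (\<Sum>i\<le>n. v i)"
    unfolding sum.distrib sum.atMost_Suc_shift by simp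
  also have "\<dots> = (\<Sum>i\<le>n. u i + v i)"
    by (simp add: sum.distrib u_def aSuc)
  also have "\<dots> = (\<Sum>i\<le>n. ?a i * ((real N + 1 - real i) * (real i + \<alpha> + 1) * ?\<phi> i + (real i + \<alpha> + \<beta> + 2) * ?\<phi> (Suc i)))"
    by (simp add: u_def v_def algebra_simps)
  also have "\<dots> = (\<Sum>i\<le>n. ?a i * ((x + \<alpha> + 1) * (real N + 1 - x) * ?\<phi> i - x * (\<beta> + real N + 2 - x) * pochhammer (1 - x) i))"
    by (simp only: pochhammer_backward_shift)
  also have "\<dots> = (x + \<alpha> + 1) * (real N + 1 - x) * (\<Sum>i\<le>n. ?a i * ?\<phi> i)
      - x * (\<beta> + real N + 2 - x) * (\<Sum>i\<le>n. ?a i * pochhammer (1 - x) i)"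
    unfolding sum_distrib_left sum_subtractf[symmetric]
    by (intro sum.cong refl) algebra
  finally show ?thesis
    by (simp add: poly_hahn_poly_eq_sum_coeff)
qed

section \<open>Summation by parts against the Hahn weight\<close>

text \<open>Together with \<open>hahn_weight_shift_right\<close>: the factors of the two terms in
  \<open>hahn_poly_backward_shift\<close> are exactly those that turn the old weight at j,
  respectively at j + 1, into the shifted weight at j.\<close>

lemma hahn_weight_shift_left:
  assumes "j \<le> N"
  shows "(\<alpha> + 1) * (\<beta> + 1) * hahn_weight (\<alpha> + 1) (\<beta> + 1) N j =
           (real j + \<alpha> + 1) * (real N + 1 - real j) * hahn_weight \<alpha> \<beta> (Suc N) j"
proof -
  have 1: "(\<alpha> + 1) * pochhammer (\<alpha> + 1 + 1) j = pochhammer (\<alpha> + 1) j * (real j + \<alpha> + 1)"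
    by (metis add.commute add.left_commute pochhammer_Suc pochhammer_rec)
  have 2: "(\<beta> + 1) * pochhammer (\<beta> + 1 + 1) (N - j) = pochhammer (\<beta> + 1) (Suc N - j)"
    using assms by (simp add: pochhammer_rec Suc_diff_le)
  have 3: "fact (Suc N - j) = (real N + 1 - real j) * fact (N - j)"
    using assms by (simp add: Suc_diff_le of_nat_diff)
  have 4: "real N + 1 - real j \<noteq> 0" using assms by linarith
  have "(\<alpha> + 1) * (\<beta> + 1) * hahn_weight (\<alpha> + 1) (\<beta> + 1) N j =
     ((\<alpha> + 1) * pochhammer (\<alpha> + 1 + 1) j) * ((\<beta> + 1) * pochhammer (\<beta> + 1 + 1) (N - j)) / (fact j * fact (N - j))"
    by (simp add: hahn_weight_def)
  also have "\<dots> = (real j + \<alpha> + 1) * (real N + 1 - real j) * hahn_weight \<alpha> \<beta> (Suc N) j"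
  proof -
    have "P * t * R / (f * g) = t * d * (P * R / (f * (d * g)))" if "d \<noteq> 0" for P t R f g d :: real
      using that by simp
    then show ?thesis
      unfolding 1 2 hahn_weight_def 3 using 4 by blast
  qed
  finally show ?thesis .
qed

lemma hahn_weight_shift_right:
  assumes "j \<le> N"
  shows "(\<alpha> + 1) * (\<beta> + 1) * hahn_weight (\<alpha> + 1) (\<beta> + 1) N j =
           (real j + 1) * (\<beta> + real N + 1 - real j) * hahn_weight \<alpha> \<beta> (Suc N) (Suc j)"
proof -
  have 1: "(\<alpha> + 1) * pochhammer (\<alpha> + 1 + 1) j = pochhammer (\<alpha> + 1) (Suc j)"
    by (simp add: pochhammer_rec)
  have 2: "(\<beta> + 1) * pochhammer (\<beta> + 1 + 1) (N - j) = pochhammer (\<beta> + 1) (N - j) * (\<beta> + real N + 1 - real j)"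
    using pochhammer_rec[of "\<beta> + 1" "N - j"] pochhammer_Suc[of "\<beta> + 1" "N - j"] assms
    by (simp add: of_nat_diff algebra_simps)
  have "(\<alpha> + 1) * (\<beta> + 1) * hahn_weight (\<alpha> + 1) (\<beta> + 1) N j =
     ((\<alpha> + 1) * pochhammer (\<alpha> + 1 + 1) j) * ((\<beta> + 1) * pochhammer (\<beta> + 1 + 1) (N - j)) / (fact j * fact (N - j))"
    by (simp add: hahn_weight_def)
  also have "\<dots> = (real j + 1) * (\<beta> + real N + 1 - real j) * hahn_weight \<alpha> \<beta> (Suc N) (Suc j)"
  proof -
    have *: "a * (b * t) / (c * d) = u * t * (a * b / ((u * c) * d))" if "u \<noteq> 0" for a b c d t u :: real
      using that by simp
    show ?thesis
      unfolding 1 2 hahn_weight_def diff_Suc_Suc fact_Suc of_nat_mult of_nat_Suc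
      by (subst *[of "1 + real j"]) (auto simp: add_ac)
  qed
  finally show ?thesis .
qed

text \<open>By the backward shift and the two weight identities, weight times polynomial is a
  constant times the backward difference of the shifted weight times the shifted polynomial.
  Summation by parts moves that difference to \<open>y\<close>.\<close>

lemma sum_hahn_by_parts:
  fixes y :: "nat \<Rightarrow> complex"
  assumes "\<alpha> > -1" "\<beta> > -1" "n \<le> N"
  shows "(\<Sum>j\<le>Suc N. of_real (hahn_weight \<alpha> \<beta> (Suc N) j * poly (hahn_poly (Suc n) \<alpha> \<beta> (Suc N)) (real j)) * y j) =
    of_real ((\<beta> + 1) / (real N + 1)) *
      (\<Sum>j\<le>N. of_real (hahn_weight (\<alpha> + 1) (\<beta> + 1) N j * poly (hahn_poly n (\<alpha> + 1) (\<beta> + 1) N) (real j)) * (y j - y (Suc j)))"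
proof -
  let ?w = "hahn_weight \<alpha> \<beta> (Suc N)" and ?w' = "hahn_weight (\<alpha> + 1) (\<beta> + 1) N"
  let ?Q = "\<lambda>x. poly (hahn_poly (Suc n) \<alpha> \<beta> (Suc N)) x" and ?Q' = "\<lambda>x. poly (hahn_poly n (\<alpha> + 1) (\<beta> + 1) N) x"
  have nz: "\<alpha> + 1 \<noteq> 0" "\<beta> + 1 \<noteq> 0" "real N + 1 \<noteq> 0" using assms by auto
  \<comment> \<open>The two halves of the backward shift, written with the old weight so that they
    make sense on all of 0..N+1. The factor N + 1 - j kills \<open>A\<close> at the upper end, the
    factor j kills \<open>B\<close> at 0, and \<open>B (Suc j) = A j\<close> in between.\<close>
  define A where "A j = ?w j * ((real j + \<alpha> + 1) * (real N + 1 - real j) * ?Q' (real j)) / ((\<alpha> + 1) * (\<beta> + 1))" for j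
  define B where "B j = ?w j * (real j * (\<beta> + real N + 2 - real j) * ?Q' (real j - 1)) / ((\<alpha> + 1) * (\<beta> + 1))" for j
  have A: "A j = ?w' j * ?Q' (real j)" if "j \<le> N" for j
  proof -
    have "A j * ((\<alpha> + 1) * (\<beta> + 1)) = ?w' j * ?Q' (real j) * ((\<alpha> + 1) * (\<beta> + 1))"
      using hahn_weight_shift_left[OF that, of \<alpha> \<beta>] nz by (simp add: A_def) algebra
    with nz show ?thesis by simp
  qed
  have B: "B (Suc j) = ?w' j * ?Q' (real j)" if "j \<le> N" for j
  proof -
    have "B (Suc j) * ((\<alpha> + 1) * (\<beta> + 1)) = ?w' j * ?Q' (real j) * ((\<alpha> + 1) * (\<beta> + 1))"
      using hahn_weight_shift_right[OF that, of \<alpha> \<beta>] nz by (simp add: B_def) algebra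
    with nz show ?thesis by simp
  qed
  have AN: "A (Suc N) = 0" and B0: "B 0 = 0"
    by (simp_all add: A_def B_def)
  have "?w j * ?Q (real j) = (\<beta> + 1) / (real N + 1) * (A j - B j)" for j
  proof -
    have "(\<alpha> + 1) * (real N + 1) * (?w j * ?Q (real j)) = ?w j * ((\<alpha> + 1) * (real N + 1) * ?Q (real j))"
      by simp
    also have "\<dots> = (A j - B j) * ((\<alpha> + 1) * (\<beta> + 1))"
    proof -
      have "w * (X - Y) = (w * X / c - w * Y / c) * c" if "c \<noteq> 0" for w X Y c :: real
        using that by (simp add: left_diff_distrib right_diff_distrib)
      note * = this
      show ?thesis
        unfolding hahn_poly_backward_shift[OF assms(1,3)] A_def B_def
        by (rule *) (use nz in simp)
    qed
    finally have eq: "(\<alpha> + 1) * (real N + 1) * (?w j * ?Q (real j)) = (A j - B j) * ((\<alpha> + 1) * (\<beta> + 1))" .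
    have "W = b / c * D" if "a * c * W = D * (a * b)" "a \<noteq> 0" "c \<noteq> 0" for a b c D W :: real
    proof -
      from that have "a * (c * W) = a * (b * D)" by (simp add: mult_ac)
      with that have "c * W = b * D" by simp
      with that show ?thesis by (simp add: field_simps)
    qed
    from this[OF eq] nz show ?thesis by blast
  qed
  note wQ = this
  have "(\<Sum>j\<le>Suc N. of_real (?w j * ?Q (real j)) * y j) =
     of_real ((\<beta> + 1) / (real N + 1)) * ((\<Sum>j\<le>Suc N. of_real (A j) * y j) - (\<Sum>j\<le>Suc N. of_real (B j) * y j))"
    unfolding wQ sum_subtractf[symmetric] sum_distrib_left
    by (intro sum.cong refl) (simp only: of_real_mult of_real_diff left_diff_distrib right_diff_distrib mult.assoc)
  also have "(\<Sum>j\<le>Suc N. of_real (A j) * y j) = (\<Sum>j\<le>N. of_real (?w' j * ?Q' (real j)) * y j)"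
    using A AN by simp
  also have "(\<Sum>j\<le>Suc N. of_real (B j) * y j) = (\<Sum>j\<le>N. of_real (?w' j * ?Q' (real j)) * y (Suc j))"
    by (subst sum.atMost_Suc_shift) (use B B0 in simp)
  finally show ?thesis
    by (simp add: sum_subtractf right_diff_distrib)
qed

abbreviation neg_forward_diff :: "(nat \<Rightarrow> complex) \<Rightarrow> nat \<Rightarrow> complex" where
  "neg_forward_diff y \<equiv> \<lambda>j. y j - y (Suc j)"

text \<open>Each summation by parts lowers degree and N by one and raises alpha and beta by one,
  hence the induction over arbitrary parameters and \<open>y\<close>. At degree 0 the polynomial is
  1 and only the weight is left; the constant is the product of the factors (beta + 1) / (N + 1) of
  the single steps.\<close>

lemma sum_hahn_Rodrigues:
  fixes y :: "nat \<Rightarrow> complex"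
  assumes "\<alpha> > -1" "\<beta> > -1"
  shows "(\<Sum>j\<le>n + m. of_real (hahn_weight \<alpha> \<beta> (n + m) j * poly (hahn_poly n \<alpha> \<beta> (n + m)) (real j)) * y j) =
    of_real (pochhammer (\<beta> + 1) n * fact m / fact (n + m)) *
      (\<Sum>j\<le>m. of_real (hahn_weight (\<alpha> + real n) (\<beta> + real n) m j) * (neg_forward_diff ^^ n) y j)"
  using assms
proof (induction n arbitrary: \<alpha> \<beta> y)
  case 0
  have "poly (hahn_poly 0 \<alpha> \<beta> m) x = 1" for x
    by (simp add: poly_hahn_poly)
  then show ?case by simp
next
  case (Suc n)
  have "\<alpha> + 1 > -1" "\<beta> + 1 > -1" using Suc.prems by auto
  note IH = Suc.IH[OF this, of "neg_forward_diff y"]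
  have "(\<beta> + 1) / (real (n + m) + 1) * (pochhammer (\<beta> + 1 + 1) n * fact m / fact (n + m))
      = pochhammer (\<beta> + 1) (Suc n) * fact m / fact (Suc n + m)"
    by (simp add: pochhammer_rec field_simps)
  then have "of_real ((\<beta> + 1) / (real (n + m) + 1)) * of_real (pochhammer (\<beta> + 1 + 1) n * fact m / fact (n + m))
      = (of_real (pochhammer (\<beta> + 1) (Suc n) * fact m / fact (Suc n + m)) :: complex)"
    by (metis of_real_mult)
  note c = this[unfolded add_Suc]
  have e: "\<alpha> + real (Suc n) = \<alpha> + 1 + real n" "\<beta> + real (Suc n) = \<beta> + 1 + real n"
    by simp_all
  have le: "n \<le> n + m" by simp
  show ?case
    unfolding add_Suc sum_hahn_by_parts[OF Suc.prems le] IH c[symmetric] e funpow_Suc_right comp_def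
    by (simp only: mult.assoc)
qed

lemma neg_forward_diff_power: "(neg_forward_diff ^^ n) (\<lambda>j. z ^ j) = (\<lambda>j. (1 - z) ^ n * z ^ j)"
  by (induction n) (auto simp: algebra_simps)

text \<open>Under this difference \<open>pochhammer (- of_nat j) k\<close> behaves like a power
  under differentiation. The value 0 for k < n becomes orthogonality to lower degrees.\<close>

lemma neg_forward_diff_pochhammer:
  "(neg_forward_diff ^^ n) (\<lambda>j. pochhammer (- of_nat j) k) =
     (\<lambda>j. if n \<le> k then (fact k / fact (k - n)) * pochhammer (- of_nat j) (k - n) else 0)"
proof (induction n)
  case 0
  then show ?case by simp
next
  case (Suc n)
  have *: "pochhammer (- of_nat j) (Suc i) - pochhammer (- of_nat (Suc j)) (Suc i)
      = of_nat (Suc i) * pochhammer (- of_nat j :: complex) i" for i j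
  proof -
    have 1: "pochhammer (- of_nat (Suc j) :: complex) (Suc i) = - of_nat (Suc j) * pochhammer (- of_nat j) i"
      by (simp add: pochhammer_rec)
    have 2: "pochhammer (- of_nat j :: complex) (Suc i) = pochhammer (- of_nat j) i * (- of_nat j + of_nat i)"
      by (rule pochhammer_Suc)
    show ?thesis
      unfolding 1 2 by (simp add: algebra_simps)
  qed
  show ?case
  proof (cases "n < k")
    case True
    then obtain i where i: "k - n = Suc i" by (metis Suc_diff_Suc)
    then have "k - Suc n = i" by simp
    show ?thesis
    proof
      fix j
      have "(neg_forward_diff ^^ Suc n) (\<lambda>j. pochhammer (- of_nat j) k) j =
        fact k / fact (Suc i) * (pochhammer (- of_nat j) (Suc i) - pochhammer (- of_nat (Suc j)) (Suc i))"
        using True by (simp only: funpow.simps comp_def Suc.IH i right_diff_distrib) simp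
      also have "\<dots> = fact k / fact i * pochhammer (- of_nat j) i"
        unfolding * fact_Suc by (simp del: of_nat_Suc)
      finally show "(neg_forward_diff ^^ Suc n) (\<lambda>j. pochhammer (- of_nat j) k) j =
          (if Suc n \<le> k then fact k / fact (k - Suc n) * pochhammer (- of_nat j) (k - Suc n) else 0)"
        using True \<open>k - Suc n = i\<close> by simp
    qed
  next
    case False
    show ?thesis
    proof
      fix j
      show "(neg_forward_diff ^^ Suc n) (\<lambda>j. pochhammer (- of_nat j) k) j =
          (if Suc n \<le> k then fact k / fact (k - Suc n) * pochhammer (- of_nat j) (k - Suc n) else 0)"
        using False by (simp only: funpow.simps comp_def Suc.IH) auto
    qed
  qed
qed

section \<open>Total mass, hypergeometric form of the weight, and norm\<close>

lemma sum_hahn_weight: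
  "(\<Sum>j\<le>m. hahn_weight \<alpha> \<beta> m j) = pochhammer (\<alpha> + \<beta> + 2) m / fact m"
proof -
  have "pochhammer (\<alpha> + \<beta> + 2) m = pochhammer ((\<alpha> + 1) + (\<beta> + 1)) m"
    by (simp add: add_ac)
  also have "\<dots> = (\<Sum>k\<le>m. real (m choose k) * pochhammer (\<alpha> + 1) k * pochhammer (\<beta> + 1) (m - k))"
    by (rule pochhammer_binomial_sum)
  also have "\<dots> = (\<Sum>k\<le>m. fact m * hahn_weight \<alpha> \<beta> m k)"
    by (intro sum.cong refl) (auto simp: hahn_weight_def binomial_fact field_simps)
  finally show ?thesis by (simp add: sum_distrib_left field_simps)
qed

text \<open>Reversing (beta+1)_(m-j) and (m-j)! turns the weight into a term of the 2F1 in the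
  transfer function. The denominator (-beta-m)_j is nonzero for j <= m because beta > -1.\<close>

lemma hahn_weight_eq_hypergeom:
  assumes "\<beta> > -1" "j \<le> m"
  shows "hahn_weight \<alpha> \<beta> m j = pochhammer (\<beta> + 1) m / fact m *
     (pochhammer (- real m) j * pochhammer (\<alpha> + 1) j / pochhammer (- \<beta> - real m) j / fact j)"
proof -
  have 1: "pochhammer (\<beta> + 1) m = pochhammer (\<beta> + 1) (m - j) * (pochhammer (- \<beta> - real m) j * (-1)^j)"
  proof -
    have "pochhammer (\<beta> + 1) m = pochhammer (\<beta> + 1) (m - j) * pochhammer (\<beta> + 1 + real (m - j)) j"
      using assms by (subst pochhammer_product[of "m - j" m]) auto
    also have "\<beta> + 1 + real (m - j) = (\<beta> + real m) - real j + 1"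
      using assms by (simp add: of_nat_diff)
    also have "pochhammer ((\<beta> + real m) - real j + 1) j = pochhammer (- \<beta> - real m) j * (-1)^j"
      using pochhammer_minus'[of "\<beta> + real m" j] by (simp add: mult_ac)
    finally show ?thesis .
  qed
  have 2: "pochhammer (- real m) j = (-1)^j * (fact m / fact (m - j))"
  proof -
    have "pochhammer (- real m) j = (-1)^j * pochhammer (real m - real j + 1) j"
      by (rule pochhammer_minus)
    also have "real m - real j + 1 = 1 + real (m - j)" using assms by (simp add: of_nat_diff)
    also have "pochhammer (1 + real (m - j)) j = fact m / fact (m - j)"
      using pochhammer_product[of "m - j" m "1::real"] assms
      by (simp add: pochhammer_fact[symmetric] field_simps)
    finally show ?thesis .
  qed
  have 3: "pochhammer (- \<beta> - real m) j \<noteq> 0"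
    using assms by (auto simp: pochhammer_eq_0_iff)
  have 4: "(-1)^j * (-1::real)^j = 1" by (simp flip: power_mult_distrib)
  show ?thesis
    unfolding hahn_weight_def 1 2 using 3 4
    by (simp add: field_simps)
qed

lemma lead_coeff_hahn_poly:
  assumes "\<alpha> > -1" "\<beta> > -1" "1 \<le> n" "n \<le> N"
  shows "lead_coeff (hahn_poly n \<alpha> \<beta> N) = (-1) ^ n * hahn_coeff n \<alpha> \<beta> N n"
    and "hahn_coeff n \<alpha> \<beta> N n \<noteq> 0"
proof -
  have p: "pochhammer [:0, -1:] k = (\<Prod>i<k. [:real i, -1:])" for k
    by (simp add: pochhammer_prod of_nat_poly lessThan_atLeast0)
  have d: "degree (pochhammer [:0, -1::real:] k) = k" for k
    unfolding p by (subst degree_prod_sum_eq) auto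
  have l: "coeff (pochhammer [:0, -1::real:] k) k = (-1)^k" for k
    using lead_coeff_prod[of "\<lambda>i. [:real i, -1:]" "{..<k}"] d[of k] by (simp add: p)
  have z: "coeff (pochhammer [:0, -1::real:] k) n = 0" if "k < n" for k
    using d[of k] that by (simp add: coeff_eq_0)
  \<comment> \<open>With n >= 1 one has n + alpha + beta + 1 > 0, and n <= N keeps (-N)_n away from
    0.\<close>
  show nz: "hahn_coeff n \<alpha> \<beta> N n \<noteq> 0"
    unfolding hahn_coeff_def
    using assms by (auto simp: pochhammer_eq_0_iff)
  have c: "coeff (hahn_poly n \<alpha> \<beta> N) n = (-1) ^ n * hahn_coeff n \<alpha> \<beta> N n"
  proof -
    have "coeff (hahn_poly n \<alpha> \<beta> N) n = (\<Sum>k\<le>n. hahn_coeff n \<alpha> \<beta> N k * coeff (pochhammer [:0, -1:] k) n)"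
      by (simp add: hahn_poly_eq_sum_coeff coeff_sum)
    also have "\<dots> = (\<Sum>k\<le>n. if k = n then (-1) ^ n * hahn_coeff n \<alpha> \<beta> N n else 0)"
      by (intro sum.cong refl) (auto simp: z l)
    finally show ?thesis by simp
  qed
  have "degree (hahn_poly n \<alpha> \<beta> N) \<le> n"
    unfolding hahn_poly_eq_sum_coeff
    by (rule degree_sum_le) (auto intro: order_trans[OF degree_smult_le] simp: d)
  moreover have "degree (hahn_poly n \<alpha> \<beta> N) \<ge> n"
    by (rule le_degree) (use c nz in auto)
  ultimately show "lead_coeff (hahn_poly n \<alpha> \<beta> N) = (-1) ^ n * hahn_coeff n \<alpha> \<beta> N n"
    using c by (simp add: le_antisym)
qed

text \<open>Expand one of the two factors Q_n in the basis (-j)_k. By the Rodrigues formula only k =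
  n survives, and there the n-fold difference is the constant n!, leaving the total mass of the
  shifted weight.\<close>

lemma hahn_norm_eq:
  assumes "\<alpha> > -1" "\<beta> > -1"
  shows "hahn_norm n \<alpha> \<beta> (n + m) = hahn_coeff n \<alpha> \<beta> (n + m) n * fact n *
     (pochhammer (\<beta> + 1) n * fact m / fact (n + m) * (pochhammer (\<alpha> + \<beta> + 2 * real n + 2) m / fact m))"
proof -
  let ?N = "n + m"
  let ?K = "pochhammer (\<beta> + 1) n * fact m / fact ?N"
  let ?w = "hahn_weight \<alpha> \<beta> ?N" and ?Q = "\<lambda>x. poly (hahn_poly n \<alpha> \<beta> ?N) x"
  let ?w' = "hahn_weight (\<alpha> + real n) (\<beta> + real n) m"
  let ?a = "hahn_coeff n \<alpha> \<beta> ?N"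
  have s: "(\<Sum>j\<le>m. ?w' j) = pochhammer (\<alpha> + \<beta> + 2 * real n + 2) m / fact m"
    by (subst sum_hahn_weight) (simp add: algebra_simps)
  have k: "(\<Sum>j\<le>?N. ?w j * ?Q (real j) * pochhammer (- real j) k) = (if k = n then fact n * (?K * sum ?w' {..m}) else 0)"
    if "k \<le> n" for k
  proof -
    have "complex_of_real (\<Sum>j\<le>?N. ?w j * ?Q (real j) * pochhammer (- real j) k)
       = (\<Sum>j\<le>?N. of_real (?w j * ?Q (real j)) * pochhammer (- of_nat j) k)"
      by (simp flip: pochhammer_of_real)
    also have "\<dots> = of_real ?K * (\<Sum>j\<le>m. of_real (?w' j) *
        (if n \<le> k then fact k / fact (k - n) * pochhammer (- of_nat j) (k - n) else 0))"
      unfolding sum_hahn_Rodrigues[OF assms] neg_forward_diff_pochhammer ..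
    also have "\<dots> = complex_of_real (if k = n then fact n * (?K * sum ?w' {..m}) else 0)"
      using that by (auto simp: sum_distrib_left sum_distrib_right sum_divide_distrib mult_ac)
    finally show ?thesis by (simp only: of_real_eq_iff)
  qed
  have "hahn_norm n \<alpha> \<beta> ?N = (\<Sum>j\<le>?N. \<Sum>k\<le>n. ?a k * (?w j * ?Q (real j) * pochhammer (- real j) k))"
    unfolding hahn_norm_def atLeast0AtMost power2_eq_square
    by (subst (2) poly_hahn_poly_eq_sum_coeff) (simp add: sum_distrib_left sum_distrib_right mult_ac)
  also have "\<dots> = (\<Sum>k\<le>n. ?a k * (\<Sum>j\<le>?N. ?w j * ?Q (real j) * pochhammer (- real j) k))"
    by (subst sum.swap) (simp add: sum_distrib_left)
  also have "\<dots> = (\<Sum>k\<le>n. if k = n then ?a n * (fact n * (?K * sum ?w' {..m})) else 0)"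
    by (intro sum.cong refl) (auto simp: k)
  finally show ?thesis by (simp add: s)
qed

lemma hahn_generating_function:
  assumes "\<alpha> > -1" "\<beta> > -1" "1 \<le> n" "n \<le> N"
  shows "(-1) ^ n * of_real (lead_coeff (hahn_poly n \<alpha> \<beta> N) * fact n / hahn_norm n \<alpha> \<beta> N) *
     (\<Sum>j=0..N. of_real (hahn_weight \<alpha> \<beta> N j * poly (hahn_poly n \<alpha> \<beta> N) (real j)) * z ^ j) =
     (1 - z) ^ n *
     complex_of_real
       (Gamma (real N + \<beta> + 1) * Gamma (2 * real n + \<alpha> + \<beta> + 2) /
        (Gamma (real n + \<beta> + 1) * Gamma (real N + real n + \<alpha> + \<beta> + 2))) *
     hypergeom_terminating (N - n) (of_real (\<alpha> + real n + 1)) (of_real (- \<beta> - real N)) z"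
proof -
  define m where "m = N - n"
  have N: "N = n + m" using assms by (simp add: m_def)
  let ?K = "pochhammer (\<beta> + 1) n * fact m / fact N"
  let ?S = "pochhammer (\<alpha> + \<beta> + 2 * real n + 2) m / fact m"
  let ?H = "hypergeom_terminating m (of_real (\<alpha> + real n + 1)) (of_real (- \<beta> - real N)) z"
  have "pochhammer (\<beta> + 1) n \<noteq> 0" "?S \<noteq> 0"
    using assms by (auto simp: pochhammer_eq_0_iff)
  then have nz: "?K \<noteq> 0" "?S \<noteq> 0" by auto
  \<comment> \<open>The top coefficient and n! occur in both numerator and norm and cancel, so the
    normalization depends only on the Rodrigues constant and the total mass.\<close>
  have c: "lead_coeff (hahn_poly n \<alpha> \<beta> N) * fact n / hahn_norm n \<alpha> \<beta> N = (-1)^n / (?K * ?S)"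
    unfolding lead_coeff_hahn_poly(1)[OF assms] hahn_norm_eq[OF assms(1,2), of n m, folded N]
    using lead_coeff_hahn_poly(2)[OF assms] by (simp add: field_simps)
  have H: "(\<Sum>j\<le>m. of_real (hahn_weight (\<alpha> + real n) (\<beta> + real n) m j) * z ^ j)
      = of_real (pochhammer (real n + \<beta> + 1) m / fact m) * ?H"
    unfolding hypergeom_terminating_def sum_distrib_left atLeast0AtMost
  proof (intro sum.cong refl, goal_cases)
    case (1 j)
    have e: "\<beta> + real n + 1 = real n + \<beta> + 1" "- (\<beta> + real n) - real m = - \<beta> - real N"
      by (simp_all add: N)
    have "hahn_weight (\<alpha> + real n) (\<beta> + real n) m j = pochhammer (real n + \<beta> + 1) m / fact m *
     (pochhammer (- real m) j * pochhammer (\<alpha> + real n + 1) j / pochhammer (- \<beta> - real N) j / fact j)"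
      using hahn_weight_eq_hypergeom[of "\<beta> + real n" j m "\<alpha> + real n"] 1 assms
      unfolding e by simp
    then show ?case by (simp add: pochhammer_of_real[symmetric])
  qed
  have g: "pochhammer (real n + \<beta> + 1) m / pochhammer (\<alpha> + \<beta> + 2 * real n + 2) m =
     Gamma (real N + \<beta> + 1) * Gamma (2 * real n + \<alpha> + \<beta> + 2) /
        (Gamma (real n + \<beta> + 1) * Gamma (real N + real n + \<alpha> + \<beta> + 2))"
  proof -
    have "real n + \<beta> + 1 > 0" "\<alpha> + \<beta> + 2 * real n + 2 > 0" using assms by auto
    then have "pochhammer (real n + \<beta> + 1) m = Gamma (real n + \<beta> + 1 + real m) / Gamma (real n + \<beta> + 1)"
       "pochhammer (\<alpha> + \<beta> + 2 * real n + 2) m = Gamma (\<alpha> + \<beta> + 2 * real n + 2 + real m) / Gamma (\<alpha> + \<beta> + 2 * real n + 2)"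
      by (auto intro!: pochhammer_Gamma dest: nonpos_Ints_nonpos)
    then show ?thesis
      by (simp add: N algebra_simps)
  qed
  have S: "(\<Sum>j=0..N. of_real (hahn_weight \<alpha> \<beta> N j * poly (hahn_poly n \<alpha> \<beta> N) (real j)) * z ^ j)
    = of_real ?K * ((1 - z) ^ n * (of_real (pochhammer (real n + \<beta> + 1) m / fact m) * ?H))"
    unfolding atLeast0AtMost N sum_hahn_Rodrigues[OF assms(1,2)] neg_forward_diff_power
    by (simp only: H[symmetric, unfolded N]) (simp add: sum_distrib_left mult_ac)
  have r: "(-1) ^ n * complex_of_real ((-1)^n / (?K * ?S)) * (of_real ?K * ((1 - z) ^ n * (of_real (pochhammer (real n + \<beta> + 1) m / fact m) * ?H)))
     = (1 - z) ^ n * of_real ((-1)^n * ((-1)^n / (?K * ?S)) * ?K * (pochhammer (real n + \<beta> + 1) m / fact m)) * ?H"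
    by (simp only: of_real_mult of_real_power of_real_minus of_real_1 mult_ac)
  have q: "(-1)^n * ((-1)^n / (?K * ?S)) * ?K * (pochhammer (real n + \<beta> + 1) m / fact m)
     = pochhammer (real n + \<beta> + 1) m / pochhammer (\<alpha> + \<beta> + 2 * real n + 2) m"
  proof -
    have "(-1)^n * ((-1)^n / (?K * ?S)) * ?K * (pochhammer (real n + \<beta> + 1) m / fact m)
      = ((-1)^n * (-1)^n) * (?K / ?K) * ((pochhammer (real n + \<beta> + 1) m / fact m) / ?S)"
      by (simp add: divide_simps)
    also have "(-1)^n * (-1::real)^n = 1" by (simp flip: power_mult_distrib)
    also have "?K / ?K = 1" using nz by simp
    finally show ?thesis by simp
  qed
  show ?thesis
    unfolding c S r q g by (simp add: m_def)
qed

section \<open>Laplace transform of the Weyl kernel\<close>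

text \<open>Extended by zero to the whole line, so that the Weyl integral becomes a correlation and
  differences can be moved to the kernel by translation.\<close>

definition weyl_kernel :: "complex \<Rightarrow> real \<Rightarrow> complex" where
  "weyl_kernel \<mu> t = indicator {0<..} t *\<^sub>R (of_real t powr (\<mu> - 1) / Gamma \<mu>)"

lemma borel_measurable_weyl_kernel [measurable]: "weyl_kernel \<mu> \<in> borel_measurable borel"
  unfolding weyl_kernel_def [abs_def] divide_inverse
  by (rule borel_measurable_continuous_on_indicator) (auto intro!: continuous_intros)

lemma has_bochner_integral_Gamma_complex:
  assumes "Re \<mu> > 0" "R > 0"
  shows "has_bochner_integral lborel (\<lambda>t. indicator {0<..} t *\<^sub>R (of_real t powr (\<mu> - 1) * exp (- of_real (R * t)))) (Gamma \<mu> * of_real R powr (- \<mu>))"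
proof -
  let ?g = "\<lambda>t. complex_of_real t powr (\<mu> - 1) / of_real (exp t)"
  have "set_integrable lebesgue {0<..} ?g"
    by (rule absolutely_integrable_Gamma_integral') fact
  then have int: "set_integrable lborel {0<..} ?g"
    unfolding set_integrable_def
    by (subst (asm) integrable_completion) (auto intro!: borel_measurable_continuous_on_indicator continuous_intros)
  have "(LINT t:{0<..}|lborel. ?g t) = Gamma \<mu>"
    using set_borel_integral_eq_integral[OF int] Gamma_integral_complex'[OF assms(1)]
    by (simp add: integral_unique)
  with int have "has_bochner_integral lborel (\<lambda>t. indicator {0<..} t *\<^sub>R ?g t) (Gamma \<mu>)"
    by (simp add: has_bochner_integral_iff set_integrable_def set_lebesgue_integral_def)
  from lborel_has_bochner_integral_real_affine_iff[THEN iffD1, OF _ this, of R 0] assms(2)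
  have "has_bochner_integral lborel (\<lambda>t. indicator {0<..} (R * t) *\<^sub>R ?g (R * t)) (Gamma \<mu> /\<^sub>R R)"
    by simp
  from has_bochner_integral_mult_right[OF this, of "of_real R powr (1 - \<mu>)"]
  have "has_bochner_integral lborel (\<lambda>t. of_real R powr (1 - \<mu>) * (indicator {0<..} (R * t) *\<^sub>R ?g (R * t)))
      (of_real R powr (1 - \<mu>) * (Gamma \<mu> /\<^sub>R R))" by simp
  moreover have "of_real R powr (1 - \<mu>) * (indicator {0<..} (R * t) *\<^sub>R ?g (R * t)) =
      indicator {0<..} t *\<^sub>R (of_real t powr (\<mu> - 1) * exp (- of_real (R * t)))" for t
  proof (cases "t > 0")
    case True
    have "of_real R powr (1 - \<mu>) * (of_real (R * t)) powr (\<mu> - 1) = complex_of_real t powr (\<mu> - 1)"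
      using assms True by (simp add: powr_times_real) (simp flip: mult.assoc powr_add)
    with True assms show ?thesis
      by (simp add: exp_minus field_simps flip: exp_of_real)
  qed (use assms in \<open>auto simp: indicator_def zero_less_mult_iff\<close>)
  moreover have "of_real R powr (1 - \<mu>) * (Gamma \<mu> /\<^sub>R R) = Gamma \<mu> * of_real R powr (- \<mu>)"
    using assms by (simp add: powr_diff powr_minus scaleR_conv_of_real field_simps)
  ultimately show ?thesis by simp
qed

text \<open>Write p = R + q with R real and |q| < R. Expanding exp(-q t) and integrating termwise
  against exp(-R t) gives Gamma integrals whose sum is the binomial series of (1 +
  q/R)^(-mu).\<close>

lemma laplace_weyl_kernel:
  assumes \<mu>: "Re \<mu> > 0" and p: "Re p > 0"
  shows "has_bochner_integral lborel (\<lambda>t. weyl_kernel \<mu> t * exp (- p * of_real t)) (p powr (- \<mu>))"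
proof -
  \<comment> \<open>The condition |p - R| < R means |p|^2 < 2 R Re p; this choice makes the right
    side 2 |p|^2.\<close>
  define R where "R = (norm p)\<^sup>2 / Re p"
  define q where "q = p - of_real R"
  have "p \<noteq> 0" using p by auto
  then have R: "R > 0" using p by (simp add: R_def)
  have "(norm q)\<^sup>2 = (norm p)\<^sup>2 - 2 * R * Re p + R\<^sup>2"
    unfolding q_def cmod_power2 by (simp add: power2_eq_square algebra_simps)
  also have "\<dots> < R\<^sup>2"
    using p \<open>p \<noteq> 0\<close> by (simp add: R_def)
  finally have q: "norm q < R"
    using R by (simp add: power_less_imp_less_base)
  define e where "e = (\<lambda>t. indicator {0<..} t *\<^sub>R (complex_of_real t powr (\<mu> - 1) * exp (- of_real (R * t))))"
  define s where "s n t = e t * (\<Sum>k<n. (- q * of_real t) ^ k /\<^sub>R fact k)" for n t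
  \<comment> \<open>The partial sums of exp(-q t) are bounded by exp(|q| t), so |q| < R is just what
    makes this majorant integrable.\<close>
  define w where "w t = norm (indicator {0<..} t *\<^sub>R (complex_of_real t powr (\<mu> - 1) * exp (- of_real ((R - norm q) * t))))" for t
  have [measurable]: "e \<in> borel_measurable borel"
    using has_bochner_integral_Gamma_complex[OF \<mu> R] by (auto simp: e_def has_bochner_integral_iff)
  have term_int: "has_bochner_integral lborel (\<lambda>t. e t * ((- q * of_real t) ^ k /\<^sub>R fact k))
      (Gamma \<mu> * of_real R powr (- \<mu>) * ((- \<mu> gchoose k) * (q / of_real R) ^ k))" for k
  proof -
    have "Re (\<mu> + of_nat k) > 0" using \<mu> by simp
    from has_bochner_integral_mult_left[OF has_bochner_integral_Gamma_complex[OF this R], of "(- q) ^ k /\<^sub>R fact k"]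
    have "has_bochner_integral lborel
      (\<lambda>t. (indicator {0<..} t *\<^sub>R (of_real t powr (\<mu> + of_nat k - 1) * exp (- of_real (R * t)))) * ((- q) ^ k /\<^sub>R fact k))
      (Gamma (\<mu> + of_nat k) * of_real R powr (- (\<mu> + of_nat k)) * ((- q) ^ k /\<^sub>R fact k))" by simp
    moreover have "(indicator {0<..} t *\<^sub>R (of_real t powr (\<mu> + of_nat k - 1) * exp (- of_real (R * t)))) * ((- q) ^ k /\<^sub>R fact k)
       = e t * ((- q * of_real t) ^ k /\<^sub>R fact k)" for t
    proof (cases "t > 0")
      case True
      have "complex_of_real t powr (\<mu> + of_nat k - 1) = of_real t powr (\<mu> - 1) * of_real t ^ k"
        using True by (simp add: powr_add powr_diff powr_nat)
      moreover have "(- q * of_real t) ^ k = (- q) ^ k * of_real t ^ k"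
        by (rule power_mult_distrib)
      ultimately show ?thesis
        unfolding e_def by simp
    qed (simp add: e_def)
    moreover have "Gamma (\<mu> + of_nat k) * of_real R powr (- (\<mu> + of_nat k)) * ((- q) ^ k /\<^sub>R fact k)
       = Gamma \<mu> * of_real R powr (- \<mu>) * ((- \<mu> gchoose k) * (q / of_real R) ^ k)"
    proof -
      have "\<mu> \<notin> \<int>\<^sub>\<le>\<^sub>0" using \<mu> by (auto elim!: nonpos_Ints_cases)
      then have 1: "Gamma (\<mu> + of_nat k) = pochhammer \<mu> k * Gamma \<mu>"
        by (simp add: pochhammer_Gamma Gamma_eq_zero_iff)
      have 2: "complex_of_real R powr (- (\<mu> + of_nat k)) = of_real R powr (- \<mu>) / of_real R ^ k"
        using R by (simp add: powr_diff powr_nat)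
      have 3: "(- q) ^ k = (-1) ^ k * q ^ k" by (rule power_minus)
      show ?thesis
        unfolding 1 2 3 gbinomial_pochhammer
        by (simp add: scaleR_conv_of_real power_divide field_simps)
    qed
    ultimately show ?thesis by simp
  qed
  have s_int: "has_bochner_integral lborel (s n) (\<Sum>k<n. Gamma \<mu> * of_real R powr (- \<mu>) * ((- \<mu> gchoose k) * (q / of_real R) ^ k))" for n
    unfolding s_def sum_distrib_left
    by (intro has_bochner_integral_sum term_int)
  have lim1: "(\<lambda>n. integral\<^sup>L lborel (s n)) \<longlonglongrightarrow> p powr (- \<mu>) * Gamma \<mu>"
  proof -
    have "norm (q / of_real R) < 1" using q R by (simp add: norm_divide)
    from sums_mult[OF gen_binomial_complex[OF this, of "- \<mu>"], of "Gamma \<mu> * of_real R powr (- \<mu>)"]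
    have "(\<lambda>n. \<Sum>k<n. Gamma \<mu> * of_real R powr (- \<mu>) * ((- \<mu> gchoose k) * (q / of_real R) ^ k))
       \<longlonglongrightarrow> Gamma \<mu> * of_real R powr (- \<mu>) * (1 + q / of_real R) powr (- \<mu>)"
      by (simp add: sums_def)
    \<comment> \<open>R is a positive real, so the principal powers multiply without a branch
      correction.\<close>
    also have "Gamma \<mu> * of_real R powr (- \<mu>) * (1 + q / of_real R) powr (- \<mu>) = Gamma \<mu> * (of_real R * (1 + q / of_real R)) powr (- \<mu>)"
      using R by (subst powr_times_real_left) auto
    also have "of_real R * (1 + q / of_real R) = p"
      using R by (simp add: q_def field_simps)
    finally show ?thesis
      using s_int by (simp add: has_bochner_integral_iff mult.commute)
  qed
  have w_int: "integrable lborel w"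
    using has_bochner_integral_Gamma_complex[OF \<mu>, of "R - norm q"] q
    unfolding w_def has_bochner_integral_iff by (intro integrable_norm) auto
  have bound: "norm (s n t) \<le> w t" for n t
  proof (cases "t > 0")
    case True
    have "norm (\<Sum>k<n. (- q * of_real t) ^ k /\<^sub>R fact k) \<le> (\<Sum>k<n. (norm q * t) ^ k /\<^sub>R fact k)"
      using True by (intro sum_norm_le) (simp add: norm_mult norm_power)
    also have "\<dots> \<le> exp (norm q * t)"
      unfolding exp_def using True by (intro sum_le_suminf summable_exp_generic) auto
    finally have "norm (s n t) \<le> norm (e t) * exp (norm q * t)"
      unfolding s_def norm_mult by (intro mult_left_mono) auto
    also have "\<dots> = w t"
      using True by (simp add: e_def w_def norm_mult norm_exp algebra_simps flip: exp_add exp_of_real)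
    finally show ?thesis .
  qed (simp add: s_def e_def w_def)
  have conv: "(\<lambda>n. s n t) \<longlonglongrightarrow> e t * exp (- q * of_real t)" for t
    unfolding s_def
    by (intro tendsto_intros) (use exp_converges[of "- q * of_real t"] in \<open>simp add: sums_def\<close>)
  have lim2: "integrable lborel (\<lambda>t. e t * exp (- q * of_real t))"
       "(\<lambda>n. integral\<^sup>L lborel (s n)) \<longlonglongrightarrow> integral\<^sup>L lborel (\<lambda>t. e t * exp (- q * of_real t))"
    by (intro integrable_dominated_convergence[where w = w and s = s]
              integral_dominated_convergence[where w = w and s = s] w_int AE_I2 conv bound;
        (simp add: s_def[abs_def]; measurable))+
  have "e t * exp (- q * of_real t) / Gamma \<mu> = weyl_kernel \<mu> t * exp (- p * of_real t)" for t
    by (cases "t > 0") (simp_all add: e_def weyl_kernel_def q_def algebra_simps flip: exp_add)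
  moreover have "has_bochner_integral lborel (\<lambda>t. e t * exp (- q * of_real t)) (p powr (- \<mu>) * Gamma \<mu>)"
    using lim2 LIMSEQ_unique[OF lim1 lim2(2)] by (simp add: has_bochner_integral_iff)
  from has_bochner_integral_mult_left[OF this, of "1 / Gamma \<mu>"]
  have "has_bochner_integral lborel (\<lambda>t. e t * exp (- q * of_real t) / Gamma \<mu>) (p powr (- \<mu>))"
  proof -
    have "\<mu> \<notin> \<int>\<^sub>\<le>\<^sub>0" using \<mu> by (auto elim!: nonpos_Ints_cases)
    with \<open>has_bochner_integral lborel (\<lambda>t. e t * exp (- q * of_real t) * (1 / Gamma \<mu>)) _\<close> show ?thesis
      by (simp add: Gamma_eq_zero_iff)
  qed
  ultimately show ?thesis by simp
qed

section \<open>Differences of the Weyl integral\<close>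

text \<open>In both applications \<open>m\<close> is a constant multiple of an exponentially damped
  kernel, integrable by its Laplace transform at p = 1. For t <= T, undoing the damping costs at
  most a factor exp(T), so the singularity at 0 needs no separate estimate.\<close>

lemma integrable_of_powr_tail:
  fixes k :: "real \<Rightarrow> complex"
  assumes [measurable]: "k \<in> borel_measurable borel"
    and m: "integrable lborel m" "\<And>t. t \<le> T \<Longrightarrow> norm (k t) \<le> norm (m t :: complex)"
    and tail: "\<And>t. t \<ge> T \<Longrightarrow> norm (k t) \<le> C * t powr e" and "e < -1" "T > 0"
  shows "integrable lborel k"
proof -
  have "(\<lambda>t. t powr e) absolutely_integrable_on {T..}"
    using has_integral_powr_to_inf[OF \<open>e < -1\<close> \<open>T > 0\<close>]
    by (subst absolutely_integrable_on_iff_nonneg) (auto simp: integrable_on_def)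
  then have "integrable lborel (\<lambda>t. indicat_real {T..} t *\<^sub>R t powr e)"
    unfolding set_integrable_def by (subst (asm) integrable_completion) auto
  then have "integrable lborel (\<lambda>t. norm (m t) + C * (indicat_real {T..} t *\<^sub>R t powr e))"
    using m by (intro Bochner_Integration.integrable_add integrable_norm integrable_mult_right) auto
  then show ?thesis
  proof (rule Bochner_Integration.integrable_bound)
    show "AE t in lborel. norm (k t) \<le> norm (norm (m t) + C * (indicat_real {T..} t *\<^sub>R t powr e))"
    proof (rule AE_I2)
      fix t
      have "0 \<le> C * t powr e" if "t \<ge> T" using order_trans[OF norm_ge_zero tail[OF that]] .
      then have "norm (k t) \<le> norm (m t) + C * (indicat_real {T..} t *\<^sub>R t powr e)"
        using m(2)[of t] tail[of t] by (cases "t \<ge> T") (auto intro: order_trans)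
      then show "norm (k t) \<le> norm (norm (m t) + C * (indicat_real {T..} t *\<^sub>R t powr e))"
        by simp
    qed
  qed simp
qed

lemma powr_le_powr_of_comparable:
  fixes s t p :: real
  assumes "t > 0" "t / 2 \<le> s" "s \<le> 2 * t"
  shows "s powr p \<le> 2 powr \<bar>p\<bar> * t powr p"
proof (cases "p \<ge> 0")
  case True
  have "s powr p \<le> (2 * t) powr p" using assms True by (intro powr_mono2) auto
  then show ?thesis using assms True by (simp add: powr_mult)
next
  case False
  have "s powr p \<le> (t / 2) powr p" using assms False by (intro powr_mono2') auto
  then show ?thesis using assms False by (simp add: powr_divide powr_minus_divide)
qed

lemma exp_diff_mult: "exp (x - y) = exp x * exp (- y)" for x y :: real
  by (simp add: exp_minus exp_diff divide_inverse)

lemma norm_weyl_kernel: "t > 0 \<Longrightarrow> norm (weyl_kernel \<mu> t) = t powr (Re \<mu> - 1) / norm (Gamma \<mu>)"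
  by (simp add: weyl_kernel_def norm_divide norm_powr_real_powr)

lemma weyl_integral_eq_kernel:
  "weyl_integral \<mu> f x = (LINT t|lborel. f (x + t) * weyl_kernel \<mu> t)"
proof -
  have "weyl_integral \<mu> f x = (LINT y|lborel. 1 / Gamma \<mu> * (indicator {x..} y *\<^sub>R (f y * complex_of_real (y - x) powr (\<mu> - 1))))"
    unfolding weyl_integral_def set_lebesgue_integral_def by (simp only: integral_mult_right_zero)
  also have "\<dots> = (LINT t|lborel. 1 / Gamma \<mu> * (indicator {x..} (x + t) *\<^sub>R (f (x + t) * complex_of_real t powr (\<mu> - 1))))"
    by (subst lborel_integral_real_affine[of 1 _ x]) auto
  also have "\<dots> = (LINT t|lborel. f (x + t) * weyl_kernel \<mu> t)"
  proof (intro Bochner_Integration.integral_cong refl)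
    show "1 / Gamma \<mu> * (indicator {x..} (x + t) *\<^sub>R (f (x + t) * complex_of_real t powr (\<mu> - 1))) = f (x + t) * weyl_kernel \<mu> t" for t
      by (cases "t = 0") (auto simp: weyl_kernel_def indicator_def)
  qed
  finally show ?thesis .
qed

text \<open>Near 0 the kernel is integrable and f is bounded; at infinity the exponents -Re mu -
  epsilon and Re mu - 1 add up to -epsilon - 1.\<close>

lemma integrable_times_weyl_kernel:
  fixes f :: "real \<Rightarrow> complex"
  assumes \<mu>: "Re \<mu> > 0" and f: "continuous_on UNIV f" and "\<epsilon> > 0"
    and O: "f \<in> O[at_top](\<lambda>x. complex_of_real (x powr (- Re \<mu> - \<epsilon>)))"
  shows "integrable lborel (\<lambda>t. f (x + t) * weyl_kernel \<mu> t)"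
proof -
  have [measurable]: "f \<in> borel_measurable borel"
    using f by (rule borel_measurable_continuous_onI)
  let ?p = "- Re \<mu> - \<epsilon>"
  obtain C where "C > 0" and "eventually (\<lambda>y. norm (f y) \<le> C * norm (complex_of_real (y powr ?p))) at_top"
    using O by (elim landau_o.bigE)
  then obtain X where X: "norm (f y) \<le> C * y powr ?p" if "y \<ge> X" for y
    by (auto simp: eventually_at_top_linorder)
  \<comment> \<open>For t >= T one has |x| <= t/2, so x + t is comparable with t, and also x + t >=
    X.\<close>
  define T where "T = 1 + 2 * \<bar>x\<bar> + \<bar>X\<bar>"
  have "bounded ((\<lambda>t. f (x + t)) ` {0..T})"
    by (intro compact_imp_bounded compact_continuous_image continuous_on_compose2[OF f]) (auto intro!: continuous_intros)
  then obtain B :: real where "B > 0" and B: "\<And>t. t \<in> {0..T} \<Longrightarrow> norm (f (x + t)) \<le> B"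
    by (auto simp: bounded_pos)
  show ?thesis
  proof (rule integrable_of_powr_tail)
    show "integrable lborel (\<lambda>t. of_real (B * exp T) * (weyl_kernel \<mu> t * exp (- 1 * of_real t)))"
      using laplace_weyl_kernel[OF \<mu>, of 1] by (intro integrable_mult_right) (auto simp: has_bochner_integral_iff)
    show "norm (f (x + t) * weyl_kernel \<mu> t) \<le> norm (of_real (B * exp T) * (weyl_kernel \<mu> t * exp (- 1 * of_real t)))"
      if "t \<le> T" for t
    proof (cases "t > 0")
      case True
      have "norm (f (x + t)) * 1 \<le> B * exp (T - t)"
        using B[of t] True that \<open>B > 0\<close> by (intro mult_mono) auto
      then have "norm (f (x + t)) * norm (weyl_kernel \<mu> t) \<le> B * exp (T - t) * norm (weyl_kernel \<mu> t)"
        by (intro mult_right_mono) auto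
      also have "\<dots> = norm (of_real (B * exp T) * (weyl_kernel \<mu> t * exp (- 1 * of_real t)))"
        using \<open>B > 0\<close> by (simp add: norm_mult exp_diff_mult)
      finally show ?thesis by (simp add: norm_mult)
    qed (simp add: weyl_kernel_def)
    show "norm (f (x + t) * weyl_kernel \<mu> t) \<le> C * 2 powr \<bar>?p\<bar> / norm (Gamma \<mu>) * t powr (- \<epsilon> - 1)" if "T \<le> t" for t
    proof -
      have t: "t > 0" "t / 2 \<le> x + t" "x + t \<le> 2 * t" "x + t \<ge> X"
        using that by (auto simp: T_def)
      have "norm (f (x + t)) \<le> C * (x + t) powr ?p" using X t by blast
      also have "\<dots> \<le> C * (2 powr \<bar>?p\<bar> * t powr ?p)"
        using \<open>C > 0\<close> t by (intro mult_left_mono powr_le_powr_of_comparable) auto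
      finally have "norm (f (x + t) * weyl_kernel \<mu> t) \<le> C * (2 powr \<bar>?p\<bar> * t powr ?p) * (t powr (Re \<mu> - 1) / norm (Gamma \<mu>))"
        unfolding norm_mult using t \<open>C > 0\<close> by (intro mult_mono) (auto simp: norm_weyl_kernel)
      also have "\<dots> = C * 2 powr \<bar>?p\<bar> / norm (Gamma \<mu>) * (t powr ?p * t powr (Re \<mu> - 1))"
        by simp
      also have "t powr ?p * t powr (Re \<mu> - 1) = t powr (- \<epsilon> - 1)"
        by (simp flip: powr_add)
      finally show ?thesis .
    qed
  qed (use \<open>\<epsilon> > 0\<close> in \<open>auto simp: T_def\<close>)
qed

section \<open>Iterated differences\<close>

text \<open>The argument type is generic because kernels are differenced over the reals, while the
  decay estimate differences \<open>powr\<close> over the complex numbers, where its derivative is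
  available. A negative step gives differences with x + h.\<close>

primrec iterdiff :: "nat \<Rightarrow> 'a::ab_group_add \<Rightarrow> ('a \<Rightarrow> complex) \<Rightarrow> 'a \<Rightarrow> complex" where
  "iterdiff 0 h k t = k t"
| "iterdiff (Suc m) h k t = iterdiff m h k t - iterdiff m h k (t - h)"

lemma iterdiff_0_fun: "iterdiff 0 h k = k"
  and iterdiff_Suc_fun: "iterdiff (Suc m) h k = (\<lambda>t. iterdiff m h k t - iterdiff m h k (t - h))"
  by (simp_all add: fun_eq_iff)

lemma borel_measurable_iterdiff:
  fixes k :: "real \<Rightarrow> complex"
  assumes "k \<in> borel_measurable borel"
  shows "iterdiff M h k \<in> borel_measurable borel"
proof (induction M)
  case (Suc M)
  note [measurable] = this
  show ?case by (simp)
qed (use assms in simp)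

lemma has_bochner_integral_shift:
  fixes F :: "real \<Rightarrow> complex"
  assumes "has_bochner_integral lborel F I"
  shows "has_bochner_integral lborel (\<lambda>x. F (x + h)) I"
  using lborel_has_bochner_integral_real_affine_iff[of 1 F I h] assms by (simp add: add.commute)

text \<open>Replacing \<open>k t\<close> by \<open>k (t - h)\<close> shifts the correlation from x
  to x + h, hence the opposite step on the right.\<close>

lemma iterdiff_correlation:
  fixes f k :: "real \<Rightarrow> complex"
  assumes "\<And>x. has_bochner_integral lborel (\<lambda>t. f (x + t) * k t) (v x)"
  shows "has_bochner_integral lborel (\<lambda>t. f (x + t) * iterdiff M h k t) (iterdiff M (- h) v x)"
proof (induction M arbitrary: x)
  case (Suc M)
  have "has_bochner_integral lborel (\<lambda>t. f (x + t) * iterdiff M h k (t - h)) (iterdiff M (- h) v (x + h))"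
    using has_bochner_integral_shift[OF Suc.IH[of "x + h"], of "- h"] by (simp add: algebra_simps)
  from has_bochner_integral_diff[OF Suc.IH[of x] this] show ?case
    by (simp add: right_diff_distrib)
qed (use assms in simp)

lemma laplace_iterdiff:
  fixes k :: "real \<Rightarrow> complex"
  assumes "has_bochner_integral lborel (\<lambda>t. k t * exp (- p * of_real t)) L"
  shows "has_bochner_integral lborel (\<lambda>t. iterdiff M h k t * exp (- p * of_real t)) ((1 - exp (- p * of_real h)) ^ M * L)"
proof (induction M)
  case (Suc M)
  have int: "has_bochner_integral lborel (\<lambda>t. exp (- p * of_real h) * (iterdiff M h k (t - h) * exp (- p * of_real (t - h))))
      (exp (- p * of_real h) * ((1 - exp (- p * of_real h)) ^ M * L))"
    using has_bochner_integral_shift[OF Suc.IH, of "- h"] by (intro has_bochner_integral_mult_right) simp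
  have "exp (- p * of_real h) * (iterdiff M h k (t - h) * exp (- p * of_real (t - h)))
     = iterdiff M h k (t - h) * exp (- p * of_real t)" for t
  proof -
    have "exp (- p * of_real h) * exp (- p * of_real (t - h)) = exp (- p * of_real t)"
      by (simp add: algebra_simps flip: exp_add)
    then show ?thesis by (metis mult.left_commute)
  qed
  note eq = this
  from int have "has_bochner_integral lborel (\<lambda>t. iterdiff M h k (t - h) * exp (- p * of_real t))
     (exp (- p * of_real h) * ((1 - exp (- p * of_real h)) ^ M * L))" unfolding eq .
  from has_bochner_integral_diff[OF Suc.IH this] show ?case
    by (simp add: left_diff_distrib mult.assoc)
qed (use assms in simp)

text \<open>The bound on Re z keeps all the points z, z - h, ..., z - M h in the open right
  half-plane, off the branch cut.\<close>

lemma has_field_derivative_iterdiff_powr: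
  assumes "h > 0" "Re z > real M * h"
  shows "(iterdiff M (complex_of_real h) (\<lambda>z. z powr a) has_field_derivative
           a * iterdiff M (complex_of_real h) (\<lambda>z. z powr (a - 1)) z) (at z)"
  using assms(2)
proof (induction M arbitrary: z)
  case 0
  then have "z \<notin> \<real>\<^sub>\<le>\<^sub>0" by (auto simp: complex_nonpos_Reals_iff)
  then show ?case unfolding iterdiff_0_fun by (rule has_field_derivative_powr)
next
  case (Suc M)
  have "Re z > real M * h" "Re (z - of_real h) > real M * h"
    using Suc.prems assms(1) by (auto simp: algebra_simps)
  note D1 = Suc.IH[OF this(1)] and D2 = Suc.IH[OF this(2)]
  have "((\<lambda>z. iterdiff M (of_real h) (\<lambda>z. z powr a) (z - of_real h)) has_field_derivative
      a * iterdiff M (of_real h) (\<lambda>z. z powr (a - 1)) (z - of_real h)) (at z)"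
    using DERIV_shift[of "iterdiff M (of_real h) (\<lambda>z. z powr a)" _ z "- of_real h"] D2 by simp
  from DERIV_diff[OF D1 this] show ?case
    by (simp only: iterdiff_Suc_fun right_diff_distrib)
qed

text \<open>
  Each difference gains a factor \<open>1/t\<close>, since it is bounded by the derivative, which lowers the
  exponent by one.
\<close>
lemma iterdiff_powr_bound:
  assumes "h > 0"
  shows "\<exists>C. \<forall>t\<ge>(real M + 1) * h. norm (iterdiff M (complex_of_real h) (\<lambda>z. z powr a) (of_real t)) \<le> C * t powr (Re a - real M)"
proof (induction M arbitrary: a)
  case 0
  have "norm (complex_of_real t powr a) \<le> 1 * t powr Re a" if "t \<ge> h" for t
    using that assms by (simp add: norm_powr_real_powr)
  then show ?case by (intro exI[of _ 1]) simp
next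
  case (Suc M)
  let ?D = "\<lambda>a. iterdiff M (complex_of_real h) (\<lambda>z. z powr a)"
  let ?p = "Re a - real (Suc M)"
  have "Re (a - 1) - real M = ?p" by simp
  with Suc.IH[of "a - 1"] obtain C where
    C: "norm (?D (a - 1) (of_real t)) \<le> C * t powr ?p" if "t \<ge> (real M + 1) * h" for t
    by metis
  have "C \<ge> 0"
  proof -
    have "0 \<le> C * ((real M + 1) * h) powr ?p"
      by (rule order_trans[OF norm_ge_zero C]) simp
    moreover have "((real M + 1) * h) powr ?p > 0" using assms by simp
    ultimately show ?thesis by (simp add: zero_le_mult_iff)
  qed
  have "norm (?D a (of_real t) - ?D a (of_real (t - h))) \<le> (norm a * (C * 2 powr \<bar>?p\<bar>) * h) * t powr ?p"
    if t: "t \<ge> (real (Suc M) + 1) * h" for t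
  proof -
    \<comment> \<open>As t >= (M + 2) h, every s in [t - h, t] lies in the range of the induction
      hypothesis and is comparable with t.\<close>
    have th: "t - h \<ge> (real M + 1) * h" "t > 0" "h \<le> t / 2"
    proof -
      have "0 \<le> real M * h" using assms by simp
      moreover have "real M * h + 2 * h \<le> t" using t by (simp add: algebra_simps)
      ultimately have "0 < t \<and> h \<le> t / 2 \<and> real M * h + h \<le> t - h"
        using assms(1) by linarith
      then show "t - h \<ge> (real M + 1) * h" "t > 0" "h \<le> t / 2"
        by (auto simp: algebra_simps)
    qed
    have "norm (?D a (of_real t) - ?D a (of_real (t - h)))
      \<le> (norm a * (C * (2 powr \<bar>?p\<bar> * t powr ?p))) * norm (complex_of_real t - of_real (t - h))"
    proof (rule field_differentiable_bound[where S = "of_real ` {t - h..t}" and f' = "\<lambda>z. a * ?D (a - 1) z"])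
      show "convex (complex_of_real ` {t - h..t})"
        by (intro convex_linear_image convex_real_interval) (rule bounded_linear.linear, rule bounded_linear_of_real)
      fix z assume "z \<in> complex_of_real ` {t - h..t}"
      then obtain s where s: "z = of_real s" "t - h \<le> s" "s \<le> t" by auto
      have "real M * h < (real M + 1) * h" using assms by simp
      then have "real M * h < Re z" using s th by simp
      then show "(?D a has_field_derivative a * ?D (a - 1) z) (at z within of_real ` {t - h..t})"
        by (rule has_field_derivative_at_within[OF has_field_derivative_iterdiff_powr[OF assms]])
      have "norm (?D (a - 1) z) \<le> C * s powr ?p"
        unfolding s(1) using s th by (intro C) auto
      also have "\<dots> \<le> C * (2 powr \<bar>?p\<bar> * t powr ?p)"
        using \<open>C \<ge> 0\<close> s th by (intro mult_left_mono powr_le_powr_of_comparable) auto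
      finally show "norm (a * ?D (a - 1) z) \<le> norm a * (C * (2 powr \<bar>?p\<bar> * t powr ?p))"
        unfolding norm_mult by (intro mult_left_mono) auto
    qed (use assms in \<open>auto simp del: of_real_diff\<close>)
    also have "norm (complex_of_real t - of_real (t - h)) = h"
      using assms by (simp flip: of_real_diff)
    finally show ?thesis by (simp add: mult_ac)
  qed
  then show ?case
    by (intro exI[of _ "norm a * (C * 2 powr \<bar>?p\<bar>) * h"]) simp
qed

lemma iterdiff_weyl_kernel_eq:
  assumes "h > 0" "t > real M * h"
  shows "iterdiff M h (weyl_kernel \<mu>) t = iterdiff M (complex_of_real h) (\<lambda>z. z powr (\<mu> - 1)) (of_real t) / Gamma \<mu>"
  using assms(2)
proof (induction M arbitrary: t)
  case 0
  then show ?case by (simp add: weyl_kernel_def)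
next
  case (Suc M)
  have "t > real M * h" "t - h > real M * h"
    using Suc.prems assms(1) by (auto simp: algebra_simps)
  from this[THEN Suc.IH] show ?case
    by (simp add: diff_divide_distrib)
qed

text \<open>The M-fold difference decays like t^(Re mu - 1 - M), and M > Re mu says precisely that
  this exponent is below -1.\<close>

lemma integrable_iterdiff_weyl_kernel:
  fixes h :: real and M :: nat
  assumes \<mu>: "Re \<mu> > 0" and "h > 0" "Re \<mu> < real M"
  shows "integrable lborel (iterdiff M h (weyl_kernel \<mu>))"
proof -
  define T where "T = (real M + 1) * h"
  obtain C where C: "norm (iterdiff M (complex_of_real h) (\<lambda>z. z powr (\<mu> - 1)) (of_real t)) \<le> C * t powr (Re (\<mu> - 1) - real M)"
      if "t \<ge> T" for t
    using iterdiff_powr_bound[OF \<open>h > 0\<close>, of M "\<mu> - 1"] by (auto simp: T_def)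
  let ?k = "iterdiff M h (weyl_kernel \<mu>)"
  show ?thesis
  proof (rule integrable_of_powr_tail)
    show "?k \<in> borel_measurable borel"
      by (intro borel_measurable_iterdiff) simp
    show "integrable lborel (\<lambda>t. of_real (exp T) * (?k t * exp (- 1 * of_real t)))"
      using laplace_iterdiff[OF laplace_weyl_kernel[OF \<mu>, of 1], of M h]
      by (intro integrable_mult_right) (auto simp: has_bochner_integral_iff)
    show "norm (?k t) \<le> norm (of_real (exp T) * (?k t * exp (- 1 * of_real t)))" if "t \<le> T" for t
    proof -
      have "norm (?k t) * 1 \<le> norm (?k t) * exp (T - t)"
        using that by (intro mult_left_mono) auto
      also have "\<dots> = norm (of_real (exp T) * (?k t * exp (- 1 * of_real t)))"
        by (simp add: norm_mult exp_diff_mult)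
      finally show ?thesis by simp
    qed
    show "norm (?k t) \<le> C / norm (Gamma \<mu>) * t powr (Re (\<mu> - 1) - real M)" if "T \<le> t" for t
    proof -
      have "real M * h < (real M + 1) * h" using assms by simp
      then have "t > real M * h" using that by (simp add: T_def)
      then show ?thesis
        using C[OF that] assms by (simp add: iterdiff_weyl_kernel_eq norm_divide divide_right_mono)
    qed
  qed (use assms in \<open>auto simp: T_def\<close>)
qed

lemma fourier_iterdiff_weyl_kernel:
  fixes h :: real and M :: nat
  assumes \<mu>: "Re \<mu> > 0" and h: "h > 0" "Re \<mu> < real M" and \<omega>: "\<omega> \<noteq> 0"
  shows "(LINT t|lborel. iterdiff M h (weyl_kernel \<mu>) t * exp (- (\<i> * of_real \<omega>) * of_real t)) =
     (1 - exp (- (\<i> * of_real \<omega>) * of_real h)) ^ M * (\<i> * of_real \<omega>) powr (- \<mu>)"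
proof -
  let ?k = "iterdiff M h (weyl_kernel \<mu>)"
  define p where "p n = complex_of_real (inverse (real (Suc n))) + \<i> * of_real \<omega>" for n
  have plim: "p \<longlonglongrightarrow> \<i> * of_real \<omega>"
  proof -
    have "(\<lambda>n. complex_of_real (inverse (real (Suc n))) + \<i> * of_real \<omega>) \<longlonglongrightarrow> of_real 0 + \<i> * of_real \<omega>"
      by (intro tendsto_intros LIMSEQ_inverse_real_of_nat)
    then show ?thesis by (simp add: p_def[abs_def])
  qed
  have k: "integrable lborel ?k" by (rule integrable_iterdiff_weyl_kernel[OF \<mu> h])
  then have [measurable]: "?k \<in> borel_measurable borel" by auto
  have eq: "(LINT t|lborel. ?k t * exp (- p n * of_real t)) = (1 - exp (- p n * of_real h)) ^ M * p n powr (- \<mu>)" for n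
  proof -
    have "Re (p n) > 0" by (simp add: p_def)
    from laplace_iterdiff[OF laplace_weyl_kernel[OF \<mu> this], of M h] show ?thesis
      by (simp add: has_bochner_integral_iff)
  qed
  have "(\<lambda>n. LINT t|lborel. ?k t * exp (- p n * of_real t)) \<longlonglongrightarrow> (LINT t|lborel. ?k t * exp (- (\<i> * of_real \<omega>) * of_real t))"
  proof (rule integral_dominated_convergence)
    show "integrable lborel (\<lambda>t. norm (?k t))" using k by (rule integrable_norm)
    show "AE t in lborel. (\<lambda>n. ?k t * exp (- p n * of_real t)) \<longlonglongrightarrow> ?k t * exp (- (\<i> * of_real \<omega>) * of_real t)"
      by (intro AE_I2 tendsto_intros plim)
    \<comment> \<open>Backward differences keep the support in t > 0, where |exp(-p t)| <= 1; this
      is what lets |k| itself serve as majorant.\<close>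
    have k0: "?k t = 0" if "t \<le> 0" for t
    proof -
      have "iterdiff M h (weyl_kernel \<mu>) t = 0" using that
      proof (induction M arbitrary: t)
        case (Suc M)
        then show ?case using h by simp
      qed (simp add: weyl_kernel_def)
      then show ?thesis .
    qed
    show "AE t in lborel. norm (?k t * exp (- p n * of_real t)) \<le> norm (?k t)" for n
    proof (rule AE_I2)
      fix t
      show "norm (?k t * exp (- p n * of_real t)) \<le> norm (?k t)"
        using k0[of t] by (cases "t \<le> 0") (auto simp: norm_mult p_def intro!: mult_right_le_one_le)
    qed
  qed measurable
  \<comment> \<open>For omega nonzero, i omega is off the branch cut, so the principal power is
    continuous there.\<close>
  moreover have "(\<lambda>n. (1 - exp (- p n * of_real h)) ^ M * p n powr (- \<mu>)) \<longlonglongrightarrow>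
     (1 - exp (- (\<i> * of_real \<omega>) * of_real h)) ^ M * (\<i> * of_real \<omega>) powr (- \<mu>)"
    by (intro tendsto_intros plim) (use \<omega> in \<open>auto simp: complex_nonpos_Reals_iff\<close>)
  ultimately show ?thesis
    using LIMSEQ_unique unfolding eq by blast
qed

section \<open>Fourier transforms of correlations and differences\<close>

text \<open>Convolution theorem for a correlation: f is evaluated at x + t, so the kernel meets
  exp(-i omega t). The factor 1/sqrt(2 pi) sits on \<open>v\<close> and \<open>f\<close>
  alone.\<close>

lemma fourier_correlation:
  fixes f k v :: "real \<Rightarrow> complex"
  assumes f: "integrable lborel f" and k: "integrable lborel k"
    and v: "\<And>x. v x = (LINT t|lborel. f (x + t) * k t)"
  shows "integrable lborel v"
    and "fourier v \<omega> = (LINT t|lborel. k t * exp (- (\<i> * of_real \<omega>) * of_real t)) * fourier f \<omega>"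
proof -
  interpret lborel_pair: pair_sigma_finite "lborel :: real measure" "lborel :: real measure" ..
  have [measurable]: "f \<in> borel_measurable borel" "k \<in> borel_measurable borel"
    using f k by auto
  \<comment> \<open>A unimodular weight does not affect absolute integrability: w = 1 gives
    integrability of \<open>v\<close>, the exponential gives the exchange of integrals.\<close>
  have *: "integrable (lborel \<Otimes>\<^sub>M lborel) (\<lambda>(t, x). w x * (f (x + t) * k t))"
    if [measurable]: "w \<in> borel_measurable borel" and w: "\<And>x. norm (w x) = 1" for w :: "real \<Rightarrow> complex"
  proof (rule lborel_pair.Fubini_integrable)
    have "(LINT x|lborel. norm (w x * (f (x + t) * k t))) = (LINT x|lborel. norm (f x)) * norm (k t)" for t
      using lborel_integral_real_affine[of 1 "\<lambda>x. norm (f x)" t]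
      by (simp add: norm_mult w add.commute)
    then show "integrable lborel (\<lambda>t. LINT x|lborel. norm (case (t, x) of (t, x) \<Rightarrow> w x * (f (x + t) * k t)))"
      using k by simp
    show "AE t in lborel. integrable lborel (\<lambda>x. case (t, x) of (t, x) \<Rightarrow> w x * (f (x + t) * k t))"
    proof (rule AE_I2)
      fix t
      have "integrable lborel (\<lambda>x. f (x + t) * k t)"
        using lborel_integrable_real_affine[OF f, of 1 t] by (simp add: add.commute)
      then show "integrable lborel (\<lambda>x. case (t, x) of (t, x) \<Rightarrow> w x * (f (x + t) * k t))"
        by (rule Bochner_Integration.integrable_bound) (auto simp: norm_mult w)
    qed
  qed measurable
  show "integrable lborel v"
    using lborel_pair.integrable_snd[OF *[of "\<lambda>_. 1"]] by (simp add: v[abs_def])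
  let ?e = "\<lambda>x. exp (\<i> * complex_of_real (\<omega> * x))"
  have "(LINT x|lborel. ?e x * v x) = (LINT x|lborel. LINT t|lborel. ?e x * (f (x + t) * k t))"
    by (simp add: v)
  also have "\<dots> = (LINT t|lborel. LINT x|lborel. ?e x * (f (x + t) * k t))"
    by (rule lborel_pair.Fubini_integral[OF *]) auto
  also have "\<dots> = (LINT t|lborel. k t * exp (- (\<i> * of_real \<omega>) * of_real t) * (LINT x|lborel. ?e x * f x))"
  proof (intro Bochner_Integration.integral_cong refl)
    fix t
    have "(LINT x|lborel. ?e x * f x) = (LINT x|lborel. ?e (t + x) * f (x + t))"
      by (subst lborel_integral_real_affine[of 1 _ t]) (auto simp: add.commute)
    moreover have "k t * exp (- (\<i> * of_real \<omega>) * of_real t) * (?e (t + x) * f (x + t)) = ?e x * (f (x + t) * k t)" for x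
    proof -
      have "exp (- (\<i> * of_real \<omega>) * of_real t) * ?e (t + x) = ?e x"
        by (simp add: algebra_simps flip: exp_add)
      then show ?thesis by (metis mult.assoc mult.commute)
    qed
    ultimately show "(LINT x|lborel. ?e x * (f (x + t) * k t)) = k t * exp (- (\<i> * of_real \<omega>) * of_real t) * (LINT x|lborel. ?e x * f x)"
      by (simp only: integral_mult_right_zero[symmetric])
  qed
  also have "\<dots> = (LINT t|lborel. k t * exp (- (\<i> * of_real \<omega>) * of_real t)) * (LINT x|lborel. ?e x * f x)"
    by (rule integral_mult_left_zero)
  finally show "fourier v \<omega> = (LINT t|lborel. k t * exp (- (\<i> * of_real \<omega>) * of_real t)) * fourier f \<omega>"
    unfolding fourier_def by simp
qed

lemma fourier_shift:
  "fourier (\<lambda>x. v (x + h)) \<omega> = exp (- \<i> * of_real (h * \<omega>)) * fourier v \<omega>"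
proof -
  let ?e = "\<lambda>x. exp (\<i> * complex_of_real (\<omega> * x))"
  have "(LINT x|lborel. ?e x * v x) = (LINT x|lborel. ?e (h + x) * v (x + h))"
    by (subst lborel_integral_real_affine[of 1 _ h]) (auto simp: add.commute)
  then have "exp (- \<i> * of_real (h * \<omega>)) * (LINT x|lborel. ?e x * v x) = (LINT x|lborel. exp (- \<i> * of_real (h * \<omega>)) * (?e (h + x) * v (x + h)))"
    by (simp only: integral_mult_right_zero)
  also have "\<dots> = (LINT x|lborel. ?e x * v (x + h))"
  proof (intro Bochner_Integration.integral_cong refl)
    fix x
    have "exp (- \<i> * of_real (h * \<omega>)) * ?e (h + x) = ?e x"
      by (simp add: algebra_simps flip: exp_add)
    then show "exp (- \<i> * of_real (h * \<omega>)) * (?e (h + x) * v (x + h)) = ?e x * v (x + h)"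
      by (simp only: mult.assoc[symmetric])
  qed
  finally show ?thesis by (simp add: fourier_def mult.left_commute)
qed

lemma integrable_shift:
  fixes v :: "real \<Rightarrow> complex"
  shows "integrable lborel v \<Longrightarrow> integrable lborel (\<lambda>x. v (x + h))"
  using lborel_integrable_real_affine[of v 1 h] by (simp add: add.commute)

lemma integrable_fourier:
  assumes "integrable lborel v"
  shows "integrable lborel (\<lambda>x. exp (\<i> * complex_of_real (\<omega> * x)) * v x)"
proof (rule Bochner_Integration.integrable_bound[OF assms])
  note [measurable] = borel_measurable_integrable[OF assms]
  show "(\<lambda>x. exp (\<i> * complex_of_real (\<omega> * x)) * v x) \<in> borel_measurable lborel" by measurable
qed (simp add: norm_mult)

lemma fourier_diff:
  "integrable lborel u \<Longrightarrow> integrable lborel v \<Longrightarrow> fourier (\<lambda>x. u x - v x) \<omega> = fourier u \<omega> - fourier v \<omega>"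
  by (simp add: fourier_def right_diff_distrib integrable_fourier del: of_real_mult)

lemma fourier_sum_cmult:
  assumes "\<And>j. j \<in> J \<Longrightarrow> integrable lborel (v j)"
  shows "fourier (\<lambda>x. \<Sum>j\<in>J. c j * v j x) \<omega> = (\<Sum>j\<in>J. c j * fourier (v j) \<omega>)"
proof -
  have "(LINT x|lborel. exp (\<i> * complex_of_real (\<omega> * x)) * (\<Sum>j\<in>J. c j * v j x)) =
     (LINT x|lborel. (\<Sum>j\<in>J. c j * (exp (\<i> * complex_of_real (\<omega> * x)) * v j x)))"
    by (simp add: sum_distrib_left mult.left_commute)
  also have "\<dots> = (\<Sum>j\<in>J. c j * (LINT x|lborel. exp (\<i> * complex_of_real (\<omega> * x)) * v j x))"
    using assms by (subst Bochner_Integration.integral_sum) (auto intro!: integrable_mult_right integrable_fourier simp del: of_real_mult)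
  finally show ?thesis
    by (simp add: fourier_def sum_distrib_left mult.left_commute)
qed

lemma fourier_iterdiff:
  assumes "integrable lborel v"
  shows "integrable lborel (iterdiff M (- h) v)"
    and "fourier (iterdiff M (- h) v) \<omega> = (1 - exp (- \<i> * of_real (h * \<omega>))) ^ M * fourier v \<omega>"
proof (induction M)
  case (Suc M)
  {
    case 1
    show ?case using Suc integrable_shift[OF Suc(1), of h] by (simp add: iterdiff_Suc_fun)
  next
    case 2
    have eq: "fourier (iterdiff (Suc M) (- h) v) \<omega> = fourier (iterdiff M (- h) v) \<omega> - fourier (\<lambda>x. iterdiff M (- h) v (x + h)) \<omega>"
      using fourier_diff[OF Suc(1) integrable_shift[OF Suc(1), of h]] by (simp add: iterdiff_Suc_fun)
    show ?case
      unfolding eq fourier_shift Suc(2) by (simp add: algebra_simps)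
  }
qed (use assms in \<open>simp_all add: iterdiff_0_fun\<close>)

lemma iterdiff_sum_shift:
  fixes v :: "real \<Rightarrow> complex"
  shows "iterdiff M h (\<lambda>x. \<Sum>j\<in>J. c j * v (x + s j)) x = (\<Sum>j\<in>J. c j * iterdiff M h v (x + s j))"
proof (induction M arbitrary: x)
  case (Suc M)
  then show ?case
    by (simp add: sum_subtractf right_diff_distrib algebra_simps)
qed simp

text \<open>
  The Weyl integral need not be integrable, but an \<open>M\<close>-fold difference of it is, since the
  \<open>M\<close>-fold difference of its kernel is integrable. The step is chosen such that the multiplier
  introduced by the difference does not vanish at the given frequency.
\<close>
lemma fourier_sum_shifted_weyl_integral:
  assumes \<mu>: "Re \<mu> > 0" and f: "continuous_on UNIV f" "integrable lborel f" and "\<epsilon> > 0"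
    and O: "f \<in> O[at_top](\<lambda>x. complex_of_real (x powr (- Re \<mu> - \<epsilon>)))"
    and g: "\<And>x. g x = (\<Sum>j\<in>J. c j * weyl_integral \<mu> f (x + s j))" and gi: "integrable lborel g"
    and \<omega>: "\<omega> \<noteq> 0"
  shows "fourier g \<omega> = (\<Sum>j\<in>J. c j * exp (- \<i> * of_real (s j * \<omega>))) * (\<i> * of_real \<omega>) powr (- \<mu>) * fourier f \<omega>"
proof -
  define h where "h = pi / \<bar>\<omega>\<bar>"
  have h: "h > 0" using \<omega> by (simp add: h_def)
  obtain M :: nat where M: "Re \<mu> < real M" using reals_Archimedean2 by blast
  let ?W = "weyl_integral \<mu> f"
  define V where "V = iterdiff M (- h) ?W"
  define E where "E = (1 - exp (- (\<i> * of_real \<omega>) * of_real h)) ^ M"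
  have E': "(1 - exp (- \<i> * of_real (h * \<omega>))) ^ M = E"
    by (simp add: E_def mult_ac)
  \<comment> \<open>Here h omega is pi or -pi, so exp(-i h omega) = -1 and E = 2^M.\<close>
  have "E \<noteq> 0"
  proof -
    have "h * \<omega> = pi \<or> h * \<omega> = - pi" using \<omega> by (auto simp: h_def abs_if)
    moreover have "exp (- \<i> * of_real y) = -1" if "y = pi \<or> y = - pi" for y
      using that by (auto simp: exp_minus)
    ultimately have "exp (- \<i> * of_real (h * \<omega>)) = -1" by blast
    then show ?thesis unfolding E'[symmetric] by simp
  qed
  have "has_bochner_integral lborel (\<lambda>t. f (x + t) * weyl_kernel \<mu> t) (?W x)" for x
    using integrable_times_weyl_kernel[OF \<mu> f(1) \<open>\<epsilon> > 0\<close> O]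
    by (simp add: has_bochner_integral_iff weyl_integral_eq_kernel)
  from iterdiff_correlation[OF this] have V: "V x = (LINT t|lborel. f (x + t) * iterdiff M h (weyl_kernel \<mu>) t)" for x
    unfolding V_def has_bochner_integral_iff by simp
  note k = integrable_iterdiff_weyl_kernel[OF \<mu> h M]
  have Vi: "integrable lborel V" by (rule fourier_correlation(1)[OF f(2) k V])
  have VF: "fourier V \<omega> = E * (\<i> * of_real \<omega>) powr (- \<mu>) * fourier f \<omega>"
    unfolding fourier_correlation(2)[OF f(2) k V] fourier_iterdiff_weyl_kernel[OF \<mu> h M \<omega>] E_def ..
  \<comment> \<open>The difference of \<open>g\<close> is transformed in two ways: directly, as
    \<open>g\<close> is integrable, and as a sum of translates of the integrable \<open>V\<close>.
    Both carry the factor E.\<close>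
  have "E * fourier g \<omega> = fourier (iterdiff M (- h) g) \<omega>"
    using fourier_iterdiff(2)[OF gi, of M h \<omega>] E' by simp
  also have "iterdiff M (- h) g = (\<lambda>x. \<Sum>j\<in>J. c j * V (x + s j))"
    unfolding V_def g[abs_def] by (rule ext, rule iterdiff_sum_shift)
  also have "fourier \<dots> \<omega> = (\<Sum>j\<in>J. c j * (exp (- \<i> * of_real (s j * \<omega>)) * fourier V \<omega>))"
    by (subst fourier_sum_cmult) (simp_all add: integrable_shift Vi fourier_shift)
  also have "\<dots> = E * ((\<Sum>j\<in>J. c j * exp (- \<i> * of_real (s j * \<omega>))) * (\<i> * of_real \<omega>) powr (- \<mu>) * fourier f \<omega>)"
    unfolding VF sum_distrib_right sum_distrib_left by (intro sum.cong refl) (simp only: mult_ac)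
  finally show ?thesis
    using \<open>E \<noteq> 0\<close> by simp
qed

section \<open>The transfer function\<close>

theorem mainTheorem4:
  fixes n N :: nat and \<alpha> \<beta> \<delta> \<epsilon> :: real and \<nu> :: complex
    and f g :: "real \<Rightarrow> complex"
  assumes "1 \<le> n" and "n \<le> N"
    and "\<alpha> > -1" and "\<beta> > -1" and "\<delta> > 0"
    and "Re \<nu> < real n"
    and "continuous_on UNIV f"
    and "integrable lborel f"
    and "\<epsilon> > 0"
    and "f \<in> O[at_top](\<lambda>x. complex_of_real (x powr (Re \<nu> - real n - \<epsilon>)))"
    and "g = hahn_fractional_derivative \<nu> n \<alpha> \<beta> N \<delta> f"
    and "integrable lborel g"
  shows "\<forall>\<omega>::real. \<omega> \<noteq> 0 \<longrightarrow>
           fourier g \<omega> = hahn_transfer \<nu> n \<alpha> \<beta> N \<delta> \<omega> * fourier f \<omega>"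
proof (intro allI impI)
  fix \<omega> :: real assume \<omega>: "\<omega> \<noteq> 0"
  define \<mu> where "\<mu> = of_nat n - \<nu>"
  define z where "z = exp (- \<i> * of_real (\<delta> * \<omega>))"
  define C where "C = lead_coeff (hahn_poly n \<alpha> \<beta> N) * fact n / hahn_norm n \<alpha> \<beta> N"
  define u where "u j = hahn_weight \<alpha> \<beta> N j * poly (hahn_poly n \<alpha> \<beta> N) (real j)" for j
  have \<mu>: "Re \<mu> > 0" using assms(6) by (simp add: \<mu>_def)
  have O: "f \<in> O[at_top](\<lambda>x. complex_of_real (x powr (- Re \<mu> - \<epsilon>)))"
    using assms(10) by (simp add: \<mu>_def)
  have g: "g x = (\<Sum>j=0..N. ((- 1) ^ n * of_real (C * (1 / \<delta> ^ n)) * of_real (u j)) * weyl_integral \<mu> f (x + real j * \<delta>))" for x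
    unfolding assms(11) hahn_fractional_derivative_def hahn_derivative_def C_def u_def \<mu>_def
    by (simp only: sum_distrib_left mult_ac)
  \<comment> \<open>Translation by j delta contributes z^j, which turns the finite sum into the
    generating function of weight times polynomial.\<close>
  have z: "exp (- \<i> * of_real (real j * \<delta> * \<omega>)) = z ^ j" for j
    unfolding z_def exp_of_nat_mult[symmetric] by (simp add: mult_ac)
  have "fourier g \<omega> = (\<Sum>j=0..N. ((- 1) ^ n * of_real (C * (1 / \<delta> ^ n)) * of_real (u j)) * z ^ j) * (\<i> * of_real \<omega>) powr (- \<mu>) * fourier f \<omega>"
    unfolding fourier_sum_shifted_weyl_integral[OF \<mu> assms(7,8,9) O g assms(12) \<omega>] z ..
  also have "(\<Sum>j=0..N. ((- 1) ^ n * of_real (C * (1 / \<delta> ^ n)) * of_real (u j)) * z ^ j) =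
      ((- 1) ^ n * of_real C * (\<Sum>j=0..N. of_real (u j) * z ^ j)) / of_real (\<delta> ^ n)"
    by (simp add: sum_distrib_left sum_divide_distrib mult_ac)
  also have "\<dots> * (\<i> * of_real \<omega>) powr (- \<mu>) = hahn_transfer \<nu> n \<alpha> \<beta> N \<delta> \<omega>"
    unfolding C_def u_def hahn_generating_function[OF assms(3,4,1,2)] hahn_transfer_def z_def[symmetric] \<mu>_def minus_diff_eq
    by (simp add: mult_ac)
  finally show "fourier g \<omega> = hahn_transfer \<nu> n \<alpha> \<beta> N \<delta> \<omega> * fourier f \<omega>" .
qed

end
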